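(* For each $K\in\mathcal M$ let $\beta_K>0$, and let $\mathbb B^H_K$ be the diagonal matrix with $$\mathbb B^H_{K,\sigma,\sigma}=\frac{|\sigma|\,\beta_K^2}{d\;d_{K,\sigma}}\,\Lambda_K\mathbf n_{K,\sigma}\cdot\mathbf n_{K,\sigma},\qquad\mathbb B^H_{K,\sigma,\sigma'}=0\ \text{ for }\sigma\ne\sigma'.$$ Then for all $\widetilde p,\widetilde q\in\widetilde H_{\mathcal M}$, $$\int_\Omega\widehat\Lambda(x)\widehat\nabla\widehat p(x)\cdot\widehat\nabla\widehat q(x)\,dx=\sum_{K\in\mathcal M}|K|\Lambda_K\nabla_K\widetilde p_K\cdot\nabla_K\widetilde q_K+\sum_{K\in\mathcal M}S_K(\widetilde q_K)^T\mathbb B^H_KS_K(\widetilde p_K),$$ so that the nonconforming Finite Element bilinear form on the left is the bilinear form of a Generalized Hybrid scheme.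
   Context: $\Omega\subset\mathbf{R}^d$ is a bounded (polytopal) open set; $\Lambda:\Omega\to M_d(\mathbf{R})$ is bounded, measurable, symmetric and uniformly elliptic ($\Lambda(x)\xi\cdot\xi\ge\zeta|\xi|^2$ for some $\zeta>0$, a.e. $x$, all $\xi$). $\mathcal M$ is a finite partition (up to a null set) of $\Omega$ into open polytopal cells $K$. $\mathcal E_K$ is the set of faces of $K$ (relatively open subsets of hyperplanes, disjoint, contained in $\partial K$, with closures covering $\partial K$); $\mathcal E$ is the set of all faces. $|K|,|\sigma|$ are measures, $\mathbf n_{K,\sigma}$ is the unit normal to $\sigma$ outward to $K$, $\bar x_\sigma$ the center of gravity of $\sigma$, $x_K\in K$ a point with respect to which $K$ is star-shaped, $d_{K,\sigma}>0$ the distance from $x_K$ to the hyperplane containing $\sigma$, $\triangle_{K,\sigma}$ the cone with vertex $x_K$ and basis $\sigma$ (these cones partition $K$ up to a null set), $\Lambda_K$ the mean of $\Lambda$ on $K$, $\widehat\Lambda=\Lambda_K$ on $K$. $\widetilde H_{\mathcal M}$ is the space of families $\widetilde p=((p_K)_{K\in\mathcal M},(p_\sigma)_{\sigma\in\mathcal E})$ of reals, and $\widetilde p_K=(p_K,(p_\sigma)_{\sigma\in\mathcal E_K})$. Set $\nabla_K\widetilde p_K=\frac1{|K|}\sum_{\sigma\in\mathcal E_K}|\sigma|(p_\sigma-p_K)\mathbf n_{K,\sigma}$, $S_{K,\sigma}(\widetilde p_K)=p_\sigma-p_K-\nabla_K\widetilde p_K\cdot(\bar x_\sigma-x_K)$,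 $S_K(\widetilde p_K)=(S_{K,\sigma}(\widetilde p_K))_{\sigma\in\mathcal E_K}$. To $\widetilde p\in\widetilde H_{\mathcal M}$ one associates the piecewise affine function $\widehat p$ given for a.e. $x\in\triangle_{K,\sigma}$ by $\widehat p(x)=p_K+\big(\nabla_K\widetilde p_K+\frac{\beta_K}{d_{K,\sigma}}S_{K,\sigma}(\widetilde p_K)\mathbf n_{K,\sigma}\big)\cdot(x-x_K)$, and its broken gradient $\widehat\nabla\widehat p(x)=\nabla_K\widetilde p_K+\frac{\beta_K}{d_{K,\sigma}}S_{K,\sigma}(\widetilde p_K)\mathbf n_{K,\sigma}$ for a.e. $x\in\triangle_{K,\sigma}$. The bilinear form of a Generalized Hybrid scheme is $(\widetilde p,\widetilde q)\mapsto\sum_K|K|\Lambda_K\nabla_K\widetilde p_K\cdot\nabla_K\widetilde q_K+\sum_KS_K(\widetilde q_K)^T\mathbb B^H_KS_K(\widetilde p_K)$ with $\mathbb B^H_K$ symmetric positive definite matrices indexed by $\mathcal E_K$. *)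

theory Defs
  imports "HOL-Analysis.Analysis"
begin

section \<open>Lebesgue measure on affine subspaces\<close>

text \<open>Lebesgue measure of an affine subspace \<open>H\<close>, transported from orthonormal coordinates of \<open>H\<close>.
  The measure depends neither on the origin \<open>a\<close> nor on the orthonormal basis \<open>B\<close>.
  If \<open>H\<close> is a point then \<open>B\<close> is empty and the measure is the Dirac mass, so that a face has
  measure 1 in dimension one.\<close>

definition affine_lborel :: "'a::euclidean_space set \<Rightarrow> 'a measure" where
  "affine_lborel H = (SOME \<mu>. \<exists>a B.
      a \<in> H \<and> pairwise orthogonal B \<and> (\<forall>b\<in>B. norm b = 1) \<and> span B = (\<lambda>y. y - a) ` H \<and>
      \<mu> = distr (\<Pi>\<^sub>M b\<in>B. (lborel :: real measure)) borel (\<lambda>c. a + (\<Sum>b\<in>B. c b *\<^sub>R b)))"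

text \<open>For a nonempty relatively open subset of a hyperplane, the affine hull is that hyperplane.\<close>

definition face_measure :: "'a::euclidean_space set \<Rightarrow> real" where
  "face_measure \<sigma> = measure (affine_lborel (affine hull \<sigma>)) \<sigma>"

definition face_centroid :: "'a::euclidean_space set \<Rightarrow> 'a" where
  "face_centroid \<sigma> =
     (1 / face_measure \<sigma>) *\<^sub>R set_lebesgue_integral (affine_lborel (affine hull \<sigma>)) \<sigma> (\<lambda>y. y)"

section \<open>Polytopal meshes\<close>

definition polytopal_open :: "'a::euclidean_space set \<Rightarrow> bool" where
  "polytopal_open U \<longleftrightarrow>
     open U \<and> bounded U \<and> (\<exists>\<P>. finite \<P> \<and> (\<forall>P\<in>\<P>. polytope P) \<and> frontier U = \<Union>\<P>)"

definition null_partition :: "'i set \<Rightarrow> ('i \<Rightarrow> 'a::euclidean_space set) \<Rightarrow> 'a set \<Rightarrow> bool" where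
  "null_partition I C A \<longleftrightarrow> finite I \<and> disjoint_family_on C I \<and>
     (\<Union>i\<in>I. C i) \<subseteq> A \<and> negligible (A - (\<Union>i\<in>I. C i))"

definition rel_open_in_hyperplane :: "'a::euclidean_space set \<Rightarrow> bool" where
  "rel_open_in_hyperplane \<sigma> \<longleftrightarrow> (\<exists>a b. a \<noteq> 0 \<and> openin (top_of_set {y. a \<bullet> y = b}) \<sigma>)"

definition outward_unit_normal :: "'a::euclidean_space set \<Rightarrow> 'a set \<Rightarrow> 'a" where
  "outward_unit_normal K \<sigma> = (THE n. norm n = 1 \<and> (\<forall>y\<in>\<sigma>. \<forall>z\<in>\<sigma>. n \<bullet> (y - z) = 0) \<and>
     (\<forall>y\<in>\<sigma>. \<forall>\<^sub>F t in at_right 0. y - t *\<^sub>R n \<in> K \<and> y + t *\<^sub>R n \<notin> K))"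

definition open_cone :: "'a::euclidean_space \<Rightarrow> 'a set \<Rightarrow> 'a set" where
  "open_cone a \<sigma> = {(1 - t) *\<^sub>R a + t *\<^sub>R y | t y. 0 < t \<and> t < 1 \<and> y \<in> \<sigma>}"

record 'a mesh =
  cells :: "'a set set"
  faces :: "'a set \<Rightarrow> 'a set set"  \<comment> \<open>the faces of each cell\<close>
  point :: "'a set \<Rightarrow> 'a"          \<comment> \<open>the point \<open>x\<^sub>K\<close> of each cell\<close>

definition all_faces :: "'a mesh \<Rightarrow> 'a set set" where
  "all_faces M = (\<Union>K\<in>cells M. faces M K)"

definition face_dist :: "'a::euclidean_space mesh \<Rightarrow> 'a set \<Rightarrow> 'a set \<Rightarrow> real" where
  "face_dist M K \<sigma> = infdist (point M K) (affine hull \<sigma>)"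

definition face_cone :: "'a::euclidean_space mesh \<Rightarrow> 'a set \<Rightarrow> 'a set \<Rightarrow> 'a set" where
  "face_cone M K \<sigma> = open_cone (point M K) \<sigma>"

text \<open>Faces are only required to be relatively open, not polytopal; the last clause (automatic for
  polytopal faces) rules out faces whose relative boundary carries positive measure.\<close>

definition polytopal_mesh :: "'a::euclidean_space set \<Rightarrow> 'a mesh \<Rightarrow> bool" where
  "polytopal_mesh \<Omega> M \<longleftrightarrow>
     polytopal_open \<Omega> \<and> null_partition (cells M) (\<lambda>K. K) \<Omega> \<and>
     (\<forall>K\<in>cells M.
        polytopal_open K \<and>
        point M K \<in> K \<and> (\<forall>y\<in>K. closed_segment (point M K) y \<subseteq> K) \<and>
        finite (faces M K) \<and> disjoint (faces M K) \<and>
        (\<forall>\<sigma>\<in>faces M K. \<sigma> \<noteq> {} \<and> rel_open_in_hyperplane \<sigma> \<and> \<sigma> \<subseteq> frontier K \<and> face_dist M K \<sigma> > 0) \<and>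
        frontier K \<subseteq> (\<Union>\<sigma>\<in>faces M K. closure \<sigma>) \<and>
        null_partition (faces M K) (face_cone M K) K)"

section \<open>Diffusion tensor\<close>

definition diffusion_tensor :: "(real^'n) set \<Rightarrow> (real^'n \<Rightarrow> real^'n^'n) \<Rightarrow> bool" where
  "diffusion_tensor \<Omega> \<Lambda> \<longleftrightarrow>
     \<Lambda> \<in> borel_measurable (lebesgue_on \<Omega>) \<and>
     (\<exists>C. AE x in lebesgue_on \<Omega>. norm (\<Lambda> x) \<le> C) \<and>
     (AE x in lebesgue_on \<Omega>. transpose (\<Lambda> x) = \<Lambda> x) \<and>
     (\<exists>\<zeta>>0. AE x in lebesgue_on \<Omega>. \<forall>\<xi>. (\<Lambda> x *v \<xi>) \<bullet> \<xi> \<ge> \<zeta> * (norm \<xi>)\<^sup>2)"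

definition cell_mean :: "(real^'n \<Rightarrow> real^'n^'n) \<Rightarrow> (real^'n) set \<Rightarrow> real^'n^'n" where
  "cell_mean \<Lambda> K = (1 / measure lebesgue K) *\<^sub>R set_lebesgue_integral lebesgue K \<Lambda>"

text \<open>In this and the two analogous sums below the sets are disjoint, so at most one term is nonzero.\<close>

definition mean_tensor ::
    "(real^'n) mesh \<Rightarrow> (real^'n \<Rightarrow> real^'n^'n) \<Rightarrow> real^'n \<Rightarrow> real^'n^'n" where
  "mean_tensor M \<Lambda> x = (\<Sum>K\<in>cells M. indicator K x *\<^sub>R cell_mean \<Lambda> K)"

section \<open>Hybrid unknowns and discrete operators\<close>

type_synonym 'a hybrid = "('a set \<Rightarrow> real) \<times> ('a set \<Rightarrow> real)"

definition hybrid_space :: "'a mesh \<Rightarrow> 'a hybrid set" where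
  "hybrid_space M = (cells M \<rightarrow>\<^sub>E UNIV) \<times> (all_faces M \<rightarrow>\<^sub>E UNIV)"

definition cell_grad :: "'a::euclidean_space mesh \<Rightarrow> 'a set \<Rightarrow> 'a hybrid \<Rightarrow> 'a" where
  "cell_grad M K p = (1 / measure lebesgue K) *\<^sub>R
     (\<Sum>\<sigma>\<in>faces M K. (face_measure \<sigma> * (snd p \<sigma> - fst p K)) *\<^sub>R outward_unit_normal K \<sigma>)"

definition face_residual ::
    "'a::euclidean_space mesh \<Rightarrow> 'a set \<Rightarrow> 'a hybrid \<Rightarrow> 'a set \<Rightarrow> real" where
  "face_residual M K p \<sigma> =
     snd p \<sigma> - fst p K - cell_grad M K p \<bullet> (face_centroid \<sigma> - point M K)"

definition cone_grad ::
    "'a::euclidean_space mesh \<Rightarrow> ('a set \<Rightarrow> real) \<Rightarrow> 'a set \<Rightarrow> 'a set \<Rightarrow> 'a hybrid \<Rightarrow> 'a" where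
  "cone_grad M \<beta> K \<sigma> p = cell_grad M K p +
     (\<beta> K / face_dist M K \<sigma> * face_residual M K p \<sigma>) *\<^sub>R outward_unit_normal K \<sigma>"

definition recon ::
    "'a::euclidean_space mesh \<Rightarrow> ('a set \<Rightarrow> real) \<Rightarrow> 'a hybrid \<Rightarrow> 'a \<Rightarrow> real" where
  "recon M \<beta> p x = (\<Sum>K\<in>cells M. \<Sum>\<sigma>\<in>faces M K.
     indicator (face_cone M K \<sigma>) x * (fst p K + cone_grad M \<beta> K \<sigma> p \<bullet> (x - point M K)))"

definition broken_grad ::
    "'a::euclidean_space mesh \<Rightarrow> ('a set \<Rightarrow> real) \<Rightarrow> 'a hybrid \<Rightarrow> 'a \<Rightarrow> 'a" where
  "broken_grad M \<beta> p x = (\<Sum>K\<in>cells M. \<Sum>\<sigma>\<in>faces M K.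
     indicator (face_cone M K \<sigma>) x *\<^sub>R cone_grad M \<beta> K \<sigma> p)"

text \<open>On the cones, which cover \<open>\<Omega>\<close> up to a null set, \<open>broken_grad\<close> is the gradient of the
  piecewise affine function \<open>recon\<close>.\<close>

lemma open_open_cone:
  fixes a :: "'a::euclidean_space"
  assumes "rel_open_in_hyperplane \<sigma>" and "infdist a (affine hull \<sigma>) > 0"
  shows "open (open_cone a \<sigma>)"
proof (cases "\<sigma> = {}")
  case True
  then show ?thesis by (simp add: open_cone_def)
next
  case False
  obtain m c U where m: "m \<noteq> 0" and U: "open U" and \<sigma>: "\<sigma> = {y. m \<bullet> y = c} \<inter> U"
    using assms(1) unfolding rel_open_in_hyperplane_def openin_open by blast
  obtain y0 where y0: "y0 \<in> \<sigma>" using False by blast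
  have "a \<notin> affine hull \<sigma>" using assms(2) by (metis infdist_zero less_irrefl)
  have ne: "c - m \<bullet> a \<noteq> 0"
  proof
    assume eq: "c - m \<bullet> a = 0"
    obtain e where e: "e > 0" "ball y0 e \<subseteq> U"
      using U y0 \<sigma> open_contains_ball by blast
    define k where "k = e / (2 * (norm (a - y0) + 1))"
    have np: "norm (a - y0) + 1 > 0" by (smt (verit) norm_ge_zero)
    have k: "k > 0" using e np by (simp add: k_def)
    have "k * norm (a - y0) < e"
    proof -
      have "k * norm (a - y0) \<le> k * (norm (a - y0) + 1)" using k by (simp add: mult_left_mono)
      also have "\<dots> = e / 2" using np by (simp add: k_def field_simps)
      also have "\<dots> < e" using e by simp
      finally show ?thesis .
    qed
    define z where "z = y0 + k *\<^sub>R (a - y0)"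
    have "z \<in> U" using e(2) \<open>k * norm (a - y0) < e\<close> k by (auto simp: z_def dist_norm subset_iff)
    moreover have "m \<bullet> z = c" using y0 \<sigma> eq by (simp add: z_def inner_simps)
    ultimately have z: "z \<in> \<sigma>" using \<sigma> by simp
    have "a = (1 - 1 / k) *\<^sub>R y0 + (1 / k) *\<^sub>R z"
      using k by (simp add: z_def algebra_simps)
    moreover have "(1 - 1 / k) *\<^sub>R y0 + (1 / k) *\<^sub>R z \<in> affine hull \<sigma>"
      using y0 z by (intro mem_affine[OF affine_affine_hull]) (auto intro: hull_inc)
    ultimately show False using \<open>a \<notin> affine hull \<sigma>\<close> by simp
  qed
  define s where "s x = (m \<bullet> (x - a)) / (c - m \<bullet> a)" for x
  have cont_s: "continuous_on A s" for A unfolding s_def by (intro continuous_intros) (use ne in auto)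
  let ?V = "{x. 0 < s x \<and> s x < 1}"
  have V: "open ?V"
    unfolding Collect_conj_eq using cont_s
    by (intro open_Int open_Collect_less) (auto intro: continuous_intros)
  have "open_cone a \<sigma> = ?V \<inter> (\<lambda>x. a + (1 / s x) *\<^sub>R (x - a)) -` U" (is "_ = ?R")
  proof (intro set_eqI iffI)
    fix x assume "x \<in> open_cone a \<sigma>"
    then obtain t y where t: "0 < t" "t < 1" "y \<in> \<sigma>" and x: "x = (1 - t) *\<^sub>R a + t *\<^sub>R y"
      unfolding open_cone_def by blast
    have xa: "x - a = t *\<^sub>R (y - a)" by (simp add: x algebra_simps)
    have "m \<bullet> (y - a) = c - m \<bullet> a" using t \<sigma> by (simp add: inner_simps)
    then have "s x = t" using ne by (simp add: s_def xa)
    then show "x \<in> ?R" using t \<sigma> by (simp add: xa)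
  next
    fix x assume x: "x \<in> ?R"
    define y where "y = a + (1 / s x) *\<^sub>R (x - a)"
    have "m \<bullet> (x - a) = s x * (c - m \<bullet> a)" using ne by (simp add: s_def)
    then have "m \<bullet> y = c" using x by (simp add: y_def inner_add_right)
    moreover have "y \<in> U" using x by (simp add: y_def)
    ultimately have "y \<in> \<sigma>" using \<sigma> by simp
    moreover have "x = (1 - s x) *\<^sub>R a + s x *\<^sub>R y" using x by (simp add: y_def algebra_simps)
    ultimately show "x \<in> open_cone a \<sigma>" using x unfolding open_cone_def by blast
  qed
  moreover have "open ?R"
  proof -
    have "continuous_on ?V (\<lambda>x. a + (1 / s x) *\<^sub>R (x - a))"
      by (intro continuous_intros cont_s) auto
    then show ?thesis using V U
      by (metis (no_types, lifting) Int_commute continuous_open_preimage)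
  qed
  ultimately show ?thesis by simp
qed

lemma face_cone_sum:
  fixes f :: "'a::euclidean_space set \<Rightarrow> 'a set \<Rightarrow> 'b::real_vector"
  assumes mesh: "polytopal_mesh \<Omega> M" and K: "K \<in> cells M" and \<sigma>: "\<sigma> \<in> faces M K"
    and x: "x \<in> face_cone M K \<sigma>"
  shows "(\<Sum>L\<in>cells M. \<Sum>\<tau>\<in>faces M L. indicator (face_cone M L \<tau>) x *\<^sub>R f L \<tau>) = f K \<sigma>"
proof -
  have fin: "finite (cells M)" "finite (faces M K)"
    and disj: "disjoint_family_on (\<lambda>K. K) (cells M)" "disjoint_family_on (face_cone M K) (faces M K)"
    and sub: "\<And>L \<tau>. L \<in> cells M \<Longrightarrow> \<tau> \<in> faces M L \<Longrightarrow> face_cone M L \<tau> \<subseteq> L"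
    using mesh K unfolding polytopal_mesh_def null_partition_def by blast+
  have out: "x \<notin> face_cone M L \<tau>" if "L \<in> cells M" "\<tau> \<in> faces M L" "L \<noteq> K" for L \<tau>
    using that disj(1) sub K \<sigma> x unfolding disjoint_family_on_def by blast
  have out': "x \<notin> face_cone M K \<tau>" if "\<tau> \<in> faces M K" "\<tau> \<noteq> \<sigma>" for \<tau>
    using that disj(2) \<sigma> x unfolding disjoint_family_on_def by blast
  have "(\<Sum>L\<in>cells M. \<Sum>\<tau>\<in>faces M L. indicator (face_cone M L \<tau>) x *\<^sub>R f L \<tau>) =
      (\<Sum>L\<in>cells M. if L = K then \<Sum>\<tau>\<in>faces M K. indicator (face_cone M K \<tau>) x *\<^sub>R f K \<tau> else 0)"
    by (intro sum.cong refl) (auto simp: out intro!: sum.neutral)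
  also have "\<dots> = (\<Sum>\<tau>\<in>faces M K. indicator (face_cone M K \<tau>) x *\<^sub>R f K \<tau>)"
    using fin K by simp
  also have "\<dots> = (\<Sum>\<tau>\<in>faces M K. if \<tau> = \<sigma> then f K \<sigma> else 0)"
    using x by (intro sum.cong refl) (auto simp: out')
  also have "\<dots> = f K \<sigma>" using fin \<sigma> by simp
  finally show ?thesis .
qed

lemma recon_has_derivative:
  assumes mesh: "polytopal_mesh \<Omega> M" and K: "K \<in> cells M" and \<sigma>: "\<sigma> \<in> faces M K"
    and x: "x \<in> face_cone M K \<sigma>"
  shows "(recon M \<beta> p has_derivative (\<lambda>h. broken_grad M \<beta> p x \<bullet> h)) (at x)"
proof -
  have "rel_open_in_hyperplane \<sigma>" "face_dist M K \<sigma> > 0"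
    using mesh K \<sigma> unfolding polytopal_mesh_def by blast+
  then have op: "open (face_cone M K \<sigma>)"
    unfolding face_cone_def face_dist_def by (intro open_open_cone)
  have g: "broken_grad M \<beta> p x = cone_grad M \<beta> K \<sigma> p"
    unfolding broken_grad_def by (rule face_cone_sum[OF mesh K \<sigma> x])
  have r: "fst p K + cone_grad M \<beta> K \<sigma> p \<bullet> (y - point M K) = recon M \<beta> p y"
    if "y \<in> face_cone M K \<sigma>" for y
    unfolding recon_def using face_cone_sum[OF mesh K \<sigma> that,
        of "\<lambda>L \<tau>. fst p L + cone_grad M \<beta> L \<tau> p \<bullet> (y - point M L)"] by simp
  have "((\<lambda>y. fst p K + cone_grad M \<beta> K \<sigma> p \<bullet> (y - point M K)) has_derivative
      (\<lambda>h. cone_grad M \<beta> K \<sigma> p \<bullet> h)) (at x)"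
    by (auto intro!: derivative_eq_intros)
  then show ?thesis unfolding g
    by (rule has_derivative_transform_within_open[OF _ op x]) (simp add: r)
qed

section \<open>Bilinear forms\<close>

definition fe_form :: "(real^'n) set \<Rightarrow> (real^'n) mesh \<Rightarrow> (real^'n \<Rightarrow> real^'n^'n) \<Rightarrow>
    ((real^'n) set \<Rightarrow> real) \<Rightarrow> (real^'n) hybrid \<Rightarrow> (real^'n) hybrid \<Rightarrow> real" where
  "fe_form \<Omega> M \<Lambda> \<beta> p q = set_lebesgue_integral lebesgue \<Omega>
     (\<lambda>x. (mean_tensor M \<Lambda> x *v broken_grad M \<beta> p x) \<bullet> broken_grad M \<beta> q x)"

definition sym_pos_def_on :: "'i set \<Rightarrow> ('i \<Rightarrow> 'i \<Rightarrow> real) \<Rightarrow> bool" where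
  "sym_pos_def_on I B \<longleftrightarrow> (\<forall>i\<in>I. \<forall>j\<in>I. B i j = B j i) \<and>
     (\<forall>v. (\<exists>i\<in>I. v i \<noteq> 0) \<longrightarrow> (\<Sum>i\<in>I. \<Sum>j\<in>I. v i * B i j * v j) > 0)"

definition hybrid_form :: "(real^'n) mesh \<Rightarrow> (real^'n \<Rightarrow> real^'n^'n) \<Rightarrow>
    ((real^'n) set \<Rightarrow> (real^'n) set \<Rightarrow> (real^'n) set \<Rightarrow> real) \<Rightarrow>
    (real^'n) hybrid \<Rightarrow> (real^'n) hybrid \<Rightarrow> real" where
  "hybrid_form M \<Lambda> B p q =
     (\<Sum>K\<in>cells M. measure lebesgue K * ((cell_mean \<Lambda> K *v cell_grad M K p) \<bullet> cell_grad M K q)) +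
     (\<Sum>K\<in>cells M. \<Sum>\<sigma>\<in>faces M K. \<Sum>\<sigma>'\<in>faces M K.
        face_residual M K q \<sigma> * B K \<sigma> \<sigma>' * face_residual M K p \<sigma>')"

definition generalized_hybrid :: "(real^'n) mesh \<Rightarrow> (real^'n \<Rightarrow> real^'n^'n) \<Rightarrow>
    ((real^'n) hybrid \<Rightarrow> (real^'n) hybrid \<Rightarrow> real) \<Rightarrow> bool" where
  "generalized_hybrid M \<Lambda> a \<longleftrightarrow> (\<exists>B. (\<forall>K\<in>cells M. sym_pos_def_on (faces M K) (B K)) \<and>
     (\<forall>p\<in>hybrid_space M. \<forall>q\<in>hybrid_space M. a p q = hybrid_form M \<Lambda> B p q))"

end

(* On each cone the broken gradient is constant, so the left-hand side is a finite sum over cones, and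
   |cone| = |\<sigma>| d_{K,\<sigma>} / d.  Expanding the products, the mixed terms vanish because the residuals satisfy
   sum_\<sigma> |\<sigma>| S_{K,\<sigma>} n_{K,\<sigma>} = 0, a consequence of sum_\<sigma> |\<sigma>| n_{K,\<sigma>} (xbar_\<sigma> - x_K)^T = |K| Id.
   The last identity is the divergence theorem on K.  It is obtained here without boundary integrals: with g the
   Minkowski gauge of K about x_K, the function max(0, 1 - g(x)) w.(x - x_K) is Lipschitz with bounded support, so the
   integrals of its partial derivatives vanish, and on each cone g(x) = n_{K,\<sigma>}.(x - x_K) / d_{K,\<sigma>}. *)
theory Submission
  imports Defs
begin

subsection \<open>Lebesgue measure in orthonormal coordinates\<close>

text \<open>The face measure lives in an orthonormal frame picked by a choice operator, so the cone
  volume formula needs the Lebesgue measure of the whole space in an arbitrary orthonormal basis;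
  this is where rotation invariance enters. Faces are relatively open sets, not polytopes, and
  integrals over them are reached only through cone integrals of homogeneous functions: degree 0
  gives the factor d_{K,\<sigma>} / d, degree 1 the factor d_{K,\<sigma>} / (d + 1). Since 1 / d - 1
  / (d + 1) = 1 / (d (d + 1)), the volume terms and the centroid terms of the gauge identity share
  the factor 1 / (d + 1), which cancels. The main obstacle is the Lipschitz bound: K need not be
  convex, so g need not be subadditive. The bound is recovered from g being continuous and equal, at
  each point, to one of finitely many affine functions. Continuity in turn rests on x_K lying off
  every face hyperplane, which prevents rays from x_K from running along the frontier.\<close>

lemma nn_integral_lborel_translate:
  fixes f :: "'a::euclidean_space \<Rightarrow> ennreal"
  assumes [measurable]: "f \<in> borel_measurable borel"
  shows "(\<integral>\<^sup>+x. f (a + x) \<partial>lborel) = (\<integral>\<^sup>+x. f x \<partial>lborel)"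
proof -
  have "(\<integral>\<^sup>+x. f x \<partial>lborel) = (\<integral>\<^sup>+x. f x \<partial>distr lborel borel ((+) a))"
    by (simp only: lborel_distr_plus)
  also have "\<dots> = (\<integral>\<^sup>+x. f (a + x) \<partial>lborel)" by (simp add: nn_integral_distr)
  finally show ?thesis ..
qed

lemma nn_integral_lborel_reflect:
  fixes f :: "'a::euclidean_space \<Rightarrow> ennreal"
  assumes [measurable]: "f \<in> borel_measurable borel"
  shows "(\<integral>\<^sup>+x. f (a - x) \<partial>lborel) = (\<integral>\<^sup>+x. f x \<partial>lborel)"
proof -
  have "(\<integral>\<^sup>+x. f x \<partial>lborel) = (\<integral>\<^sup>+x. f x \<partial>density (distr lborel borel (\<lambda>x. a + (-1) *\<^sub>R x)) (\<lambda>_. \<bar>-1::real\<bar> ^ DIM('a)))"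
    using lborel_affine[of "-1" a] by simp
  also have "\<dots> = (\<integral>\<^sup>+x. f (a - x) \<partial>lborel)"
    by (simp add: nn_integral_density nn_integral_distr)
  finally show ?thesis ..
qed

text \<open>The change of variables theory of the library requires a well-ordered index type, so invariance under
  rotations is derived from uniqueness of Haar measure: \<open>\<nu> C * \<lambda> A = \<lambda> C * \<nu> A\<close> for the Lebesgue measure \<open>\<lambda>\<close>
  and its image \<open>\<nu>\<close>, and the two measures agree on the unit ball \<open>C\<close>.\<close>

lemma lborel_distr_orthogonal_transformation:
  fixes T :: "'a::euclidean_space \<Rightarrow> 'a"
  assumes T: "orthogonal_transformation T"
  shows "distr lborel borel T = lborel"
proof (rule measure_eqI)
  have lin: "linear T" using T by (rule orthogonal_transformation_linear)
  then have [measurable]: "T \<in> borel_measurable borel"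
    by (intro borel_measurable_continuous_onI linear_continuous_on linear_conv_bounded_linear[THEN iffD1])
  have inv: "T (inv T x) = x" for x
    using orthogonal_transformation_surj[OF T] by (simp add: surj_f_inv_f)
  define \<nu> where "\<nu> = distr lborel borel T"
  have \<nu>: "(\<integral>\<^sup>+y. g (x + y) \<partial>\<nu>) = (\<integral>\<^sup>+y. g y \<partial>\<nu>)" if [measurable]: "g \<in> borel_measurable borel" for g x
  proof -
    have "(\<integral>\<^sup>+y. g (x + y) \<partial>\<nu>) = (\<integral>\<^sup>+y. g (T (inv T x + y)) \<partial>lborel)"
      by (simp add: \<nu>_def nn_integral_distr linear_add[OF lin] inv)
    also have "\<dots> = (\<integral>\<^sup>+y. g (T y) \<partial>lborel)"
      by (rule nn_integral_lborel_translate) measurable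
    finally show ?thesis by (simp add: \<nu>_def nn_integral_distr)
  qed
  have sets [measurable_cong, simp]: "sets \<nu> = sets borel" and space [simp]: "space \<nu> = UNIV"
    by (simp_all add: \<nu>_def)
  define C :: "'a set" where "C = ball 0 1"
  have [measurable]: "C \<in> sets borel" by (simp add: C_def)
  have vim: "T -` ball 0 r = ball 0 r" for r
    using orthogonal_transformation_norm[OF T] by auto
  have \<nu>ball: "emeasure \<nu> (ball 0 r) = emeasure lborel (ball 0 r :: 'a set)" for r
    by (simp add: \<nu>_def emeasure_distr vim)
  \<comment> \<open>Balls around 0 exhaust the space and have finite \<nu>-measure because
    \<open>T\<close> preserves them; Fubini for \<nu> needs this \<sigma>-finiteness.\<close>
  interpret \<nu>: sigma_finite_measure \<nu>
  proof (rule sigma_finite_measure.intro, intro exI[of _ "range (\<lambda>n. ball 0 (real n))"] conjI ballI)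
    show "\<Union> (range (\<lambda>n. ball 0 (real n))) = space \<nu>"
      using reals_Archimedean2 by (auto simp: set_eq_iff)
    show "emeasure \<nu> a \<noteq> \<infinity>" if "a \<in> range (\<lambda>n. ball 0 (real n))" for a
      using that emeasure_lborel_ball_finite[of "0::'a"] by (auto simp: \<nu>ball less_top)
  qed auto
  interpret lborel: sigma_finite_measure "lborel :: 'a measure" by (rule sigma_finite_lborel)
  interpret pair_sigma_finite "lborel :: 'a measure" \<nu> ..
  fix A assume "A \<in> sets (distr lborel borel T)"
  then have [measurable]: "A \<in> sets borel" by simp
  have m1 [measurable]: "(\<lambda>(x, y). indicator A x * indicator C (y - x) :: ennreal) \<in> borel_measurable (lborel \<Otimes>\<^sub>M \<nu>)"
    by measurable
  have m2 [measurable]: "(\<lambda>(x, y). indicator A (y - x) * indicator C x :: ennreal) \<in> borel_measurable (lborel \<Otimes>\<^sub>M \<nu>)"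
    by measurable
  \<comment> \<open>The double integral of \<open>indicator A x * indicator C (y - x)\<close> is
    evaluated twice. Translating y by x under \<nu> gives the product on the left; replacing x by y
    - x under Lebesgue measure, exchanging the integrals and translating under \<nu> again gives
    \<nu>(A) times the Lebesgue measure of C.\<close>
  have "emeasure lborel A * emeasure \<nu> C = (\<integral>\<^sup>+x. \<integral>\<^sup>+y. indicator A x * indicator C y \<partial>\<nu> \<partial>lborel)"
    by (simp add: nn_integral_cmult nn_integral_multc)
  also have "\<dots> = (\<integral>\<^sup>+x. \<integral>\<^sup>+y. indicator A x * indicator C (y - x) \<partial>\<nu> \<partial>lborel)"
  proof (rule nn_integral_cong)
    fix x :: 'a
    show "(\<integral>\<^sup>+y. indicator A x * indicator C y \<partial>\<nu>) = (\<integral>\<^sup>+y. indicator A x * indicator C (y - x) \<partial>\<nu>)"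
      by (subst \<nu>[where x = "-x", symmetric]) auto
  qed
  also have "\<dots> = (\<integral>\<^sup>+y. \<integral>\<^sup>+x. indicator A x * indicator C (y - x) \<partial>lborel \<partial>\<nu>)"
    using Fubini[OF m1] by simp
  also have "\<dots> = (\<integral>\<^sup>+y. \<integral>\<^sup>+x. indicator A (y - x) * indicator C x \<partial>lborel \<partial>\<nu>)"
  proof (rule nn_integral_cong)
    fix y :: 'a
    show "(\<integral>\<^sup>+x. indicator A x * indicator C (y - x) \<partial>lborel) = (\<integral>\<^sup>+x. indicator A (y - x) * indicator C x \<partial>lborel)"
      by (subst nn_integral_lborel_reflect[where a = y, symmetric]) (auto simp: algebra_simps)
  qed
  also have "\<dots> = (\<integral>\<^sup>+x. \<integral>\<^sup>+y. indicator A (y - x) * indicator C x \<partial>\<nu> \<partial>lborel)"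
    using Fubini[OF m2] by simp
  also have "\<dots> = (\<integral>\<^sup>+x. \<integral>\<^sup>+y. indicator A y * indicator C x \<partial>\<nu> \<partial>lborel)"
  proof (rule nn_integral_cong)
    fix x :: 'a
    show "(\<integral>\<^sup>+y. indicator A (y - x) * indicator C x \<partial>\<nu>) = (\<integral>\<^sup>+y. indicator A y * indicator C x \<partial>\<nu>)"
      by (subst (2) \<nu>[where x = "-x", symmetric]) auto
  qed
  also have "\<dots> = emeasure \<nu> A * emeasure lborel C"
    by (simp add: nn_integral_cmult nn_integral_multc)
  finally have eq: "emeasure lborel A * emeasure lborel C = emeasure \<nu> A * emeasure lborel C"
    by (simp add: \<nu>ball C_def)
  have "emeasure lborel C \<noteq> 0"
    using content_ball_pos[of 1 "0::'a"] by (auto simp: C_def measure_def)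
  moreover have "emeasure lborel C \<noteq> \<infinity>" using emeasure_lborel_ball_finite[of "0::'a" 1] by (simp add: C_def)
  ultimately show "emeasure (distr lborel borel T) A = emeasure lborel A"
    using eq by (simp add: ennreal_mult_cancel_left mult.commute[of _ "emeasure lborel C"] \<nu>_def)
qed simp

text \<open>Lebesgue measure is given as a product indexed by \<open>Basis\<close>, whereas frames
  use their own vectors as indices; this relabelling passes from one index set to the other. Both
  measures agree on boxes.\<close>

lemma distr_PiM_lborel_reindex:
  assumes I: "finite I" and J: "finite J" and \<phi>: "bij_betw \<phi> J I"
  shows "distr (\<Pi>\<^sub>M i\<in>I. (lborel :: real measure)) (\<Pi>\<^sub>M j\<in>J. lborel) (\<lambda>c. \<lambda>j\<in>J. c (\<phi> j)) =
    (\<Pi>\<^sub>M j\<in>J. lborel)"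
proof -
  interpret product_sigma_finite "\<lambda>_. lborel :: real measure" ..
  have \<phi>I: "\<phi> j \<in> I" if "j \<in> J" for j using \<phi> that by (auto dest: bij_betwE)
  have meas [measurable]: "(\<lambda>c. \<lambda>j\<in>J. c (\<phi> j)) \<in> measurable (\<Pi>\<^sub>M i\<in>I. (lborel :: real measure)) (\<Pi>\<^sub>M j\<in>J. lborel)"
    by (intro measurable_restrict measurable_component_singleton) (use \<phi>I in auto)
  show ?thesis
  proof (rule PiM_eqI[OF J])
    fix A :: "_ \<Rightarrow> real set" assume A: "\<And>j. j \<in> J \<Longrightarrow> A j \<in> sets lborel"
    let ?\<psi> = "inv_into J \<phi>"
    have inv: "\<And>j. j \<in> J \<Longrightarrow> ?\<psi> (\<phi> j) = j" "\<And>i. i \<in> I \<Longrightarrow> \<phi> (?\<psi> i) = i" "\<And>i. i \<in> I \<Longrightarrow> ?\<psi> i \<in> J"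
      using \<phi> by (auto simp: bij_betw_def inv_into_f_f f_inv_into_f inv_into_into)
    have vim: "(\<lambda>c. \<lambda>j\<in>J. c (\<phi> j)) -` Pi\<^sub>E J A \<inter> space (\<Pi>\<^sub>M i\<in>I. lborel) = (\<Pi>\<^sub>E i\<in>I. A (?\<psi> i))"
      (is "?L = ?R")
    proof (intro set_eqI iffI)
      fix c assume c: "c \<in> ?L"
      then have "c (\<phi> (?\<psi> i)) \<in> A (?\<psi> i)" if "i \<in> I" for i
        using inv(3)[OF that] by (auto simp: PiE_def Pi_def)
      then show "c \<in> ?R" using c inv by (auto simp: space_PiM PiE_def Pi_def)
    next
      fix c assume c: "c \<in> ?R"
      then have "c (\<phi> j) \<in> A j" if "j \<in> J" for j
        using \<phi>I[OF that] inv(1)[OF that] by (auto simp: PiE_def Pi_def)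
      then show "c \<in> ?L" using c by (auto simp: space_PiM PiE_def Pi_def)
    qed
    have "emeasure (distr (\<Pi>\<^sub>M i\<in>I. lborel) (\<Pi>\<^sub>M j\<in>J. lborel) (\<lambda>c. \<lambda>j\<in>J. c (\<phi> j))) (Pi\<^sub>E J A) =
        emeasure (\<Pi>\<^sub>M i\<in>I. lborel) (\<Pi>\<^sub>E i\<in>I. A (?\<psi> i))"
      by (subst emeasure_distr) (use A J in \<open>auto simp: vim intro!: sets_PiM_I_finite\<close>)
    also have "\<dots> = (\<Prod>i\<in>I. emeasure lborel (A (?\<psi> i)))"
      by (rule emeasure_PiM) (use I A inv in auto)
    also have "\<dots> = (\<Prod>j\<in>J. emeasure lborel (A j))"
      by (subst prod.reindex_bij_betw[OF \<phi>, symmetric]) (simp add: inv)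
    finally show "emeasure (distr (\<Pi>\<^sub>M i\<in>I. lborel) (\<Pi>\<^sub>M j\<in>J. lborel) (\<lambda>c. \<lambda>j\<in>J. c (\<phi> j))) (Pi\<^sub>E J A) =
        (\<Prod>j\<in>J. emeasure lborel (A j))" .
  qed simp
qed

text \<open>This is the similarity between a slice of a cone and its base, in coordinates: t is the
  ratio of the slice to the base and w a shift of origin. On boxes each coordinate contributes one
  factor 1 / t.\<close>

lemma nn_integral_PiM_lborel_affine:
  fixes w :: "'b \<Rightarrow> real"
  assumes J: "finite J" and t: "t > 0"
    and h [measurable]: "h \<in> borel_measurable (\<Pi>\<^sub>M j\<in>J. (lborel :: real measure))"
  shows "(\<integral>\<^sup>+c. h (\<lambda>j\<in>J. w j + c j / t) \<partial>(\<Pi>\<^sub>M j\<in>J. lborel)) =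
    ennreal (t ^ card J) * (\<integral>\<^sup>+c. h c \<partial>(\<Pi>\<^sub>M j\<in>J. lborel))"
proof -
  interpret product_sigma_finite "\<lambda>_. lborel :: real measure" ..
  let ?P = "\<Pi>\<^sub>M j\<in>J. (lborel :: real measure)" and ?g = "\<lambda>c. \<lambda>j\<in>J. w j + c j / t"
  have meas [measurable]: "?g \<in> measurable ?P ?P"
    by (intro measurable_restrict) measurable
  have "scale_measure (ennreal ((1 / t) ^ card J)) (distr ?P ?P ?g) = ?P"
  proof (rule PiM_eqI[OF J])
    fix A :: "_ \<Rightarrow> real set" assume A: "\<And>j. j \<in> J \<Longrightarrow> A j \<in> sets lborel"
    let ?A = "\<lambda>j. (\<lambda>x. w j + x / t) -` A j"
    have A' [measurable]: "?A j \<in> sets borel" if "j \<in> J" for j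
      by (rule measurable_sets_borel[of _ borel]) (use A that in auto)
    have *: "emeasure lborel (A j) = ennreal (1 / t) * emeasure lborel (?A j)" if "j \<in> J" for j
    proof -
      have "emeasure lborel (A j) = (\<integral>\<^sup>+x. indicator (A j) x \<partial>lborel)"
        using A that by simp
      also have "\<dots> = \<bar>1 / t\<bar> * (\<integral>\<^sup>+x. indicator (A j) (w j + 1 / t * x) \<partial>lborel)"
        by (rule nn_integral_real_affine) (use A that t in auto)
      also have "(\<integral>\<^sup>+x. indicator (A j) (w j + 1 / t * x) \<partial>lborel) = (\<integral>\<^sup>+x. indicator (?A j) x \<partial>lborel)"
        by (intro nn_integral_cong) (auto simp: indicator_def)
      also have "\<dots> = emeasure lborel (?A j)"
        using A' that by simp
      finally show ?thesis using t by simp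
    qed
    have vim: "?g -` Pi\<^sub>E J A \<inter> space ?P = Pi\<^sub>E J ?A"
      by (auto simp: space_PiM PiE_def Pi_def)
    have "emeasure (distr ?P ?P ?g) (Pi\<^sub>E J A) = emeasure ?P (Pi\<^sub>E J ?A)"
      by (subst emeasure_distr) (use A J in \<open>auto simp: vim intro!: sets_PiM_I_finite\<close>)
    also have "\<dots> = (\<Prod>j\<in>J. emeasure lborel (?A j))"
      by (rule emeasure_PiM) (use J A' in auto)
    finally show "emeasure (scale_measure (ennreal ((1 / t) ^ card J)) (distr ?P ?P ?g)) (Pi\<^sub>E J A) =
        (\<Prod>j\<in>J. emeasure lborel (A j))"
      using * t by (simp add: prod.distrib ennreal_power)
  qed simp
  then have "(\<integral>\<^sup>+c. h c \<partial>?P) = (\<integral>\<^sup>+c. h c \<partial>scale_measure (ennreal ((1 / t) ^ card J)) (distr ?P ?P ?g))"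
    by simp
  also have "\<dots> = ennreal ((1 / t) ^ card J) * (\<integral>\<^sup>+c. h (?g c) \<partial>?P)"
    by (subst nn_integral_scale_measure) (simp_all add: nn_integral_distr)
  finally have "ennreal (t ^ card J) * (\<integral>\<^sup>+c. h c \<partial>?P) =
      (ennreal (t ^ card J) * ennreal ((1 / t) ^ card J)) * (\<integral>\<^sup>+c. h (?g c) \<partial>?P)"
    by (simp add: mult.assoc)
  also have "ennreal (t ^ card J) * ennreal ((1 / t) ^ card J) = 1"
    using t by (simp flip: ennreal_mult power_mult_distrib)
  finally show ?thesis by (simp only: mult_1)
qed

text \<open>The linear map \<open>T\<close> sends the standard basis vector \<open>\<phi> b\<close>
  to \<open>b\<close>, so it preserves inner products. It carries the product representation along
  \<open>Basis\<close> to the one along \<open>B\<close>, and rotation invariance then removes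
  it.\<close>

lemma lborel_eq_distr_orthonormal_basis:
  fixes B :: "'a::euclidean_space set"
  assumes orth: "pairwise orthogonal B" and nrm: "\<And>b. b \<in> B \<Longrightarrow> norm b = 1" and card: "card B = DIM('a)"
  shows "distr (\<Pi>\<^sub>M b\<in>B. (lborel :: real measure)) borel (\<lambda>c. \<Sum>b\<in>B. c b *\<^sub>R b) = lborel"
proof -
  have fin: "finite B" using card by (intro card_ge_0_finite) simp
  obtain \<phi> where \<phi>: "bij_betw \<phi> B (Basis :: ('a) set)"
    using finite_same_card_bij[OF fin finite_Basis card] by blast
  have \<phi>B: "\<phi> b \<in> Basis" if "b \<in> B" for b
    using bij_betwE[OF \<phi>] that by blast
  define T :: "'a \<Rightarrow> 'a" where "T x = (\<Sum>b\<in>B. (x \<bullet> \<phi> b) *\<^sub>R b)" for x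
  have lin: "linear T"
    by (intro linearI) (simp_all add: T_def inner_add_left scaleR_add_left sum.distrib scaleR_sum_right)
  have ob: "b \<bullet> b' = (if b = b' then 1 else 0)" if "b \<in> B" "b' \<in> B" for b b'
    using orth nrm that by (auto simp: pairwise_def orthogonal_def dot_square_norm)
  have "T x \<bullet> T y = x \<bullet> y" for x y
  proof -
    have "T x \<bullet> T y = (\<Sum>b\<in>B. (x \<bullet> \<phi> b) * (\<Sum>b'\<in>B. (y \<bullet> \<phi> b') * (b \<bullet> b')))"
      unfolding T_def
      by (simp only: inner_sum_left inner_scaleR_left) (simp only: inner_sum_right inner_scaleR_right)
    also have "\<dots> = (\<Sum>b\<in>B. (x \<bullet> \<phi> b) * (y \<bullet> \<phi> b))"
    proof (intro sum.cong refl)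
      fix b assume b: "b \<in> B"
      have "(\<Sum>b'\<in>B. (y \<bullet> \<phi> b') * (b \<bullet> b')) = (\<Sum>b'\<in>B. if b' = b then y \<bullet> \<phi> b else 0)"
        by (intro sum.cong refl) (auto simp: ob b)
      then show "(x \<bullet> \<phi> b) * (\<Sum>b'\<in>B. (y \<bullet> \<phi> b') * (b \<bullet> b')) = (x \<bullet> \<phi> b) * (y \<bullet> \<phi> b)"
        using fin b by simp
    qed
    also have "\<dots> = (\<Sum>i\<in>Basis. (x \<bullet> i) * (y \<bullet> i))"
      by (rule sum.reindex_bij_betw[OF \<phi>])
    also have "\<dots> = x \<bullet> y" by (rule euclidean_inner[symmetric])
    finally show ?thesis .
  qed
  then have T: "orthogonal_transformation T" using lin by (simp add: orthogonal_transformation_def)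
  have [measurable]: "T \<in> borel_measurable borel"
    using lin by (intro borel_measurable_continuous_onI linear_continuous_on linear_conv_bounded_linear[THEN iffD1])
  have meas [measurable]: "(\<lambda>c. \<lambda>b\<in>B. c (\<phi> b)) \<in> measurable (\<Pi>\<^sub>M i\<in>Basis. (lborel :: real measure)) (\<Pi>\<^sub>M b\<in>B. lborel)"
    by (intro measurable_restrict measurable_component_singleton) (simp_all add: \<phi>B)
  have "distr (\<Pi>\<^sub>M b\<in>B. (lborel :: real measure)) borel (\<lambda>c. \<Sum>b\<in>B. c b *\<^sub>R b) =
      distr (distr (\<Pi>\<^sub>M i\<in>Basis. lborel) (\<Pi>\<^sub>M b\<in>B. lborel) (\<lambda>c. \<lambda>b\<in>B. c (\<phi> b))) borel (\<lambda>c. \<Sum>b\<in>B. c b *\<^sub>R b)"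
    by (simp add: distr_PiM_lborel_reindex[OF finite_Basis fin \<phi>])
  also have "\<dots> = distr (\<Pi>\<^sub>M i\<in>Basis. lborel) borel (T \<circ> (\<lambda>c. \<Sum>i\<in>Basis. c i *\<^sub>R i))"
  proof (subst distr_distr)
    have *: "((\<lambda>c. \<Sum>b\<in>B. c b *\<^sub>R b) \<circ> (\<lambda>c. \<lambda>b\<in>B. c (\<phi> b))) c = (T \<circ> (\<lambda>c. \<Sum>i\<in>Basis. c i *\<^sub>R i)) c" for c
      by (simp add: T_def \<phi>B cong: sum.cong)
    show "distr (\<Pi>\<^sub>M i\<in>Basis. lborel) borel ((\<lambda>c. \<Sum>b\<in>B. c b *\<^sub>R b) \<circ> (\<lambda>c. \<lambda>b\<in>B. c (\<phi> b))) =
        distr (\<Pi>\<^sub>M i\<in>Basis. lborel) borel (T \<circ> (\<lambda>c. \<Sum>i\<in>Basis. c i *\<^sub>R i))"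
      by (simp only: ext[OF *])
  qed simp_all
  also have "\<dots> = distr lborel borel T"
  proof -
    have "distr lborel borel T = distr (distr (\<Pi>\<^sub>M i\<in>Basis. lborel) borel (\<lambda>c. \<Sum>i\<in>Basis. c i *\<^sub>R i)) borel T"
      by (simp only: lborel_eq[symmetric])
    also have "\<dots> = distr (\<Pi>\<^sub>M i\<in>Basis. lborel) borel (T \<circ> (\<lambda>c. \<Sum>i\<in>Basis. c i *\<^sub>R i))"
      by (rule distr_distr) simp_all
    finally show ?thesis ..
  qed
  also have "\<dots> = lborel" by (rule lborel_distr_orthogonal_transformation[OF T])
  finally show ?thesis .
qed

text \<open>Since \<open>affine_lborel\<close> is defined by choice, all that is known is that it
  comes from some frame. Later computations therefore work with an origin and a basis that cannot be
  prescribed.\<close>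

lemma affine_lborel_orthonormal:
  fixes H :: "'a::euclidean_space set"
  assumes "affine H" "H \<noteq> {}"
  obtains a B where "a \<in> H" "pairwise orthogonal B" "\<And>b. b \<in> B \<Longrightarrow> norm b = 1"
    "span B = (\<lambda>y. y - a) ` H"
    "affine_lborel H = distr (\<Pi>\<^sub>M b\<in>B. (lborel :: real measure)) borel (\<lambda>c. a + (\<Sum>b\<in>B. c b *\<^sub>R b))"
proof -
  obtain a0 where a0: "a0 \<in> H" using assms by blast
  have "subspace ((\<lambda>y. y - a0) ` H)"
    using affine_diffs_subspace_subtract[OF assms(1) a0] by simp
  then obtain B0 where "pairwise orthogonal B0" "\<And>b. b \<in> B0 \<Longrightarrow> norm b = 1" "span B0 = (\<lambda>y. y - a0) ` H"
    using orthonormal_basis_subspace by metis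
  then have "\<exists>\<mu> a B. a \<in> H \<and> pairwise orthogonal B \<and> (\<forall>b\<in>B. norm b = 1) \<and> span B = (\<lambda>y. y - a) ` H \<and>
      \<mu> = distr (\<Pi>\<^sub>M b\<in>B. (lborel :: real measure)) borel (\<lambda>c. a + (\<Sum>b\<in>B. c b *\<^sub>R b))"
    using a0 by blast
  from someI_ex[OF this, folded affine_lborel_def] show ?thesis using that by blast
qed

subsection \<open>Integrals over cones\<close>

text \<open>The Gram-Schmidt remainder of v lies in the span and is orthogonal to it, hence
  vanishes.\<close>

lemma orthonormal_span_expansion:
  fixes B :: "'a::euclidean_space set"
  assumes orth: "pairwise orthogonal B" and nrm: "\<And>b. b \<in> B \<Longrightarrow> norm b = 1" and v: "v \<in> span B"
  shows "(\<Sum>b\<in>B. (b \<bullet> v) *\<^sub>R b) = v"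
proof -
  let ?w = "v - (\<Sum>b\<in>B. (b \<bullet> v / (b \<bullet> b)) *\<^sub>R b)"
  have "?w \<in> span B" by (intro span_diff v span_sum span_scale span_base)
  with orth have "orthogonal ?w ?w" by (intro Gram_Schmidt_step) auto
  then have "v = (\<Sum>b\<in>B. (b \<bullet> v / (b \<bullet> b)) *\<^sub>R b)"
    by (simp only: orthogonal_self right_minus_eq)
  also have "\<dots> = (\<Sum>b\<in>B. (b \<bullet> v) *\<^sub>R b)"
    by (intro sum.cong refl) (simp add: dot_square_norm nrm)
  finally show ?thesis ..
qed

text \<open>The height of x over a determines its cone parameter as
  \<open>N \<bullet> (x - a) / \<delta>\<close>, and the last condition says that the radial
  projection of x onto the plane of the base lies in \<sigma>. The existential in
  \<open>open_cone\<close> thereby becomes a measurable condition on x.\<close>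

lemma mem_open_cone_iff:
  assumes "\<sigma> \<subseteq> {y. N \<bullet> (y - a) = \<delta>}" "\<delta> > 0"
  shows "x \<in> open_cone a \<sigma> \<longleftrightarrow>
    0 < N \<bullet> (x - a) \<and> N \<bullet> (x - a) < \<delta> \<and> a + (\<delta> / (N \<bullet> (x - a))) *\<^sub>R (x - a) \<in> \<sigma>"
proof
  assume "x \<in> open_cone a \<sigma>"
  then obtain t y where t: "0 < t" "t < 1" and y: "y \<in> \<sigma>" and x: "x = (1 - t) *\<^sub>R a + t *\<^sub>R y"
    unfolding open_cone_def by blast
  have xa: "x - a = t *\<^sub>R (y - a)" by (simp add: x algebra_simps)
  have "N \<bullet> (y - a) = \<delta>" using y assms by auto
  then have Nx: "N \<bullet> (x - a) = t * \<delta>" by (simp only: xa inner_scaleR_right)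
  have "a + (\<delta> / (N \<bullet> (x - a))) *\<^sub>R (x - a) = y"
    unfolding Nx unfolding xa using t assms(2) by simp
  then show "0 < N \<bullet> (x - a) \<and> N \<bullet> (x - a) < \<delta> \<and> a + (\<delta> / (N \<bullet> (x - a))) *\<^sub>R (x - a) \<in> \<sigma>"
    using t y assms(2) Nx by simp
next
  let ?t = "N \<bullet> (x - a) / \<delta>"
  assume x: "0 < N \<bullet> (x - a) \<and> N \<bullet> (x - a) < \<delta> \<and> a + (\<delta> / (N \<bullet> (x - a))) *\<^sub>R (x - a) \<in> \<sigma>"
  moreover have "x = (1 - ?t) *\<^sub>R a + ?t *\<^sub>R (a + (\<delta> / (N \<bullet> (x - a))) *\<^sub>R (x - a))"
    using x assms(2) by (simp add: algebra_simps)
  moreover have "0 < ?t" "?t < 1" using x assms(2) by auto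
  ultimately show "x \<in> open_cone a \<sigma>" unfolding open_cone_def by blast
qed

lemma borel_open_cone:
  fixes \<sigma> :: "'a::euclidean_space set"
  assumes "\<sigma> \<subseteq> {y. N \<bullet> (y - a) = \<delta>}" "\<delta> > 0" and [measurable]: "\<sigma> \<in> sets borel"
  shows "open_cone a \<sigma> \<in> sets borel"
proof -
  have "open_cone a \<sigma> = {x \<in> space borel.
      0 < N \<bullet> (x - a) \<and> N \<bullet> (x - a) < \<delta> \<and> a + (\<delta> / (N \<bullet> (x - a))) *\<^sub>R (x - a) \<in> \<sigma>}"
    by (rule set_eqI) (simp only: mem_open_cone_iff[OF assms(1,2)] mem_Collect_eq space_borel UNIV_I simp_thms)
  also have "\<dots> \<in> sets borel" by measurable
  finally show ?thesis .
qed

text \<open>Slice the cone by hyperplanes parallel to the base: in orthonormal coordinates the slice at height \<open>s\<close> is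
  the base scaled by \<open>s / \<delta>\<close>.\<close>

lemma nn_integral_open_cone:
  fixes \<sigma> :: "'a::euclidean_space set" and f :: "'a \<Rightarrow> ennreal"
  assumes N: "norm N = 1" and \<delta>: "\<delta> > 0"
    and hull: "affine hull \<sigma> = {y. N \<bullet> (y - a) = \<delta>}"
    and \<sigma> [measurable]: "\<sigma> \<in> sets borel" and f [measurable]: "f \<in> borel_measurable borel"
    and hom: "\<And>t y. 0 < t \<Longrightarrow> f (a + t *\<^sub>R (y - a)) = ennreal (t ^ k) * f y"
  shows "(\<integral>\<^sup>+x\<in>open_cone a \<sigma>. f x \<partial>lborel) =
    ennreal (\<delta> / real (k + DIM('a))) * (\<integral>\<^sup>+y\<in>\<sigma>. f y \<partial>affine_lborel (affine hull \<sigma>))"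
proof -
  let ?H = "affine hull \<sigma>"
  have \<sigma>H: "\<sigma> \<subseteq> {y. N \<bullet> (y - a) = \<delta>}" using hull hull_subset[of \<sigma> affine] by simp
  note cone_iff = mem_open_cone_iff[OF \<sigma>H \<delta>]
  note [measurable] = borel_open_cone[OF \<sigma>H \<delta> \<sigma>]
  have NN: "N \<bullet> N = 1" using N by (simp add: dot_square_norm)
  then have "a + \<delta> *\<^sub>R N \<in> ?H" by (simp add: hull)
  then have "?H \<noteq> {}" by blast
  from affine_lborel_orthonormal[OF affine_affine_hull this] obtain a' B where
    a': "a' \<in> ?H" and orth: "pairwise orthogonal B" and nrm: "\<And>b. b \<in> B \<Longrightarrow> norm b = 1" and
    span: "span B = (\<lambda>y. y - a') ` ?H" and
    \<mu>: "affine_lborel ?H = distr (\<Pi>\<^sub>M b\<in>B. (lborel :: real measure)) borel (\<lambda>c. a' + (\<Sum>b\<in>B. c b *\<^sub>R b))"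
    by blast
  have spanB: "span B = {v. N \<bullet> v = 0}"
  proof -
    have "v \<in> (\<lambda>y. y - a') ` ?H" if "N \<bullet> v = 0" for v
      using that a' by (intro image_eqI[of _ _ "a' + v"]) (auto simp: hull inner_simps)
    then show ?thesis using a' by (auto simp: span hull inner_simps)
  qed
  have NB: "N \<bullet> b = 0" if "b \<in> B" for b using that spanB span_base by blast
  then have N_notin: "N \<notin> B" using NN by force
  have ind: "independent B" using orth nrm by (intro pairwise_orthogonal_independent) force+
  then have fin: "finite B" by (rule independent_imp_finite)
  have "card B = dim (span B)" using ind by (simp add: dim_eq_card_independent)
  then have cardB: "card B = DIM('a) - 1" 
    using dim_hyperplane[of N] N unfolding spanB by force
  have cardN: "card (insert N B) = DIM('a)" using fin N_notin cardB by simp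
  have orthN: "pairwise orthogonal (insert N B)"
    using orth NB by (auto simp: pairwise_insert orthogonal_def inner_commute)
  interpret product_sigma_finite "\<lambda>_. lborel :: real measure" ..
  let ?P = "\<Pi>\<^sub>M b\<in>B. (lborel :: real measure)"
  define g where "g x = f x * indicator (open_cone a \<sigma>) x" for x
  have [measurable]: "g \<in> borel_measurable borel" unfolding g_def by measurable
  define h where "h c = f (a' + (\<Sum>b\<in>B. c b *\<^sub>R b)) * indicator \<sigma> (a' + (\<Sum>b\<in>B. c b *\<^sub>R b))" for c
  have [measurable]: "h \<in> borel_measurable ?P" unfolding h_def by measurable
  \<comment> \<open>The origin \<open>a'\<close> need not be the foot of the perpendicular from a.
    The vector \<open>w\<close> holds the frame coordinates of that foot, so a slice point with
    coordinates \<open>c\<close> at height \<open>s\<close> projects to base coordinates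
    \<open>w b + c b / (s / \<delta>)\<close>.\<close>
  define w where "w b = b \<bullet> (a + \<delta> *\<^sub>R N - a')" for b
  have "N \<bullet> (a + \<delta> *\<^sub>R N - a') = 0" using a' NN by (auto simp: hull inner_simps)
  then have w: "(\<Sum>b\<in>B. w b *\<^sub>R b) = a + \<delta> *\<^sub>R N - a'"
    unfolding w_def by (intro orthonormal_span_expansion orth nrm) (auto simp: spanB)
  have slice: "g (a + (s *\<^sub>R N + (\<Sum>b\<in>B. c b *\<^sub>R b))) =
      ennreal ((s / \<delta>) ^ k) * indicator {0<..<\<delta>} s * h (\<lambda>b\<in>B. w b + c b / (s / \<delta>))" for s c
  proof -
    let ?x = "a + (s *\<^sub>R N + (\<Sum>b\<in>B. c b *\<^sub>R b))"
    have Nx: "N \<bullet> (?x - a) = s" by (simp add: inner_simps inner_sum_right NN NB)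
    show ?thesis
    proof (cases "0 < s \<and> s < \<delta>")
      case True
      \<comment> \<open>The radial projection onto the base; homogeneity moves f from the slice
        point to \<open>y\<close> at the cost of the factor (s / \<delta>)^k.\<close>
      define y where "y = a + (\<delta> / s) *\<^sub>R (?x - a)"
      have "a' + (\<Sum>b\<in>B. (\<lambda>b\<in>B. w b + c b / (s / \<delta>)) b *\<^sub>R b) =
          a' + (\<Sum>b\<in>B. w b *\<^sub>R b) + (\<delta> / s) *\<^sub>R (\<Sum>b\<in>B. c b *\<^sub>R b)"
        by (simp add: scaleR_add_left sum.distrib scaleR_sum_right mult.commute)
      also have "\<dots> = y" using True by (simp add: w y_def scaleR_add_right)
      finally have h: "h (\<lambda>b\<in>B. w b + c b / (s / \<delta>)) = f y * indicator \<sigma> y"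
        unfolding h_def by simp
      have "?x = a + (s / \<delta>) *\<^sub>R (y - a)" using True by (simp add: y_def)
      then have "f ?x = ennreal ((s / \<delta>) ^ k) * f y" using hom[of "s / \<delta>" y] True \<delta> by simp
      moreover have "indicator (open_cone a \<sigma>) ?x = (indicator \<sigma> y :: ennreal)"
        using True Nx cone_iff[of ?x] unfolding y_def by (auto simp: indicator_def)
      ultimately show ?thesis unfolding g_def h using True by (simp add: mult.assoc)
    next
      case False
      then have "?x \<notin> open_cone a \<sigma>" using Nx cone_iff[of ?x] by auto
      then show ?thesis using False by (auto simp: g_def indicator_def)
    qed
  qed
  have "(\<integral>\<^sup>+x\<in>open_cone a \<sigma>. f x \<partial>lborel) = (\<integral>\<^sup>+x. g (a + x) \<partial>lborel)"
    by (simp add: nn_integral_lborel_translate) (simp add: g_def)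
  also have "\<dots> = (\<integral>\<^sup>+x. g (a + x) \<partial>distr (\<Pi>\<^sub>M b\<in>insert N B. (lborel :: real measure)) borel (\<lambda>c. \<Sum>b\<in>insert N B. c b *\<^sub>R b))"
  proof -
    have "norm b = 1" if "b \<in> insert N B" for b using N nrm that by auto
    then show ?thesis by (simp only: lborel_eq_distr_orthonormal_basis[OF orthN _ cardN])
  qed
  also have "\<dots> = (\<integral>\<^sup>+c. g (a + (\<Sum>b\<in>insert N B. c b *\<^sub>R b)) \<partial>(\<Pi>\<^sub>M b\<in>insert N B. lborel))"
    by (rule nn_integral_distr) simp_all
  also have "\<dots> = (\<integral>\<^sup>+s. (\<integral>\<^sup>+c. g (a + (\<Sum>b\<in>insert N B. (c(N := s)) b *\<^sub>R b)) \<partial>?P) \<partial>lborel)"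
    using fin N_notin by (subst product_nn_integral_insert_rev) auto
  also have "\<dots> = (\<integral>\<^sup>+s. (\<integral>\<^sup>+c. g (a + (s *\<^sub>R N + (\<Sum>b\<in>B. c b *\<^sub>R b))) \<partial>?P) \<partial>lborel)"
  proof -
    have "(\<Sum>b\<in>insert N B. (c(N := s)) b *\<^sub>R b) = s *\<^sub>R N + (\<Sum>b\<in>B. c b *\<^sub>R b)" for c s
      using fin N_notin by (auto intro!: sum.cong)
    then show ?thesis by simp
  qed
  also have "\<dots> = (\<integral>\<^sup>+s. ennreal ((s / \<delta>) ^ (k + card B)) * indicator {0<..<\<delta>} s * integral\<^sup>N ?P h \<partial>lborel)"
  proof (rule nn_integral_cong)
    fix s :: real
    show "(\<integral>\<^sup>+c. g (a + (s *\<^sub>R N + (\<Sum>b\<in>B. c b *\<^sub>R b))) \<partial>?P) =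
        ennreal ((s / \<delta>) ^ (k + card B)) * indicator {0<..<\<delta>} s * integral\<^sup>N ?P h"
    proof (cases "0 < s \<and> s < \<delta>")
      case True
      then have t: "s / \<delta> > 0" by simp
      have [measurable]: "(\<lambda>c. h (\<lambda>b\<in>B. w b + c b / (s / \<delta>))) \<in> borel_measurable ?P"
      proof (rule measurable_compose[of _ _ ?P])
        show "(\<lambda>c. \<lambda>b\<in>B. w b + c b / (s / \<delta>)) \<in> measurable ?P ?P"
          by (intro measurable_restrict) measurable
      qed simp
      have "(\<integral>\<^sup>+c. g (a + (s *\<^sub>R N + (\<Sum>b\<in>B. c b *\<^sub>R b))) \<partial>?P) =
          ennreal ((s / \<delta>) ^ k) * (\<integral>\<^sup>+c. h (\<lambda>b\<in>B. w b + c b / (s / \<delta>)) \<partial>?P)"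
        using True by (simp only: slice) (simp add: nn_integral_cmult)
      also have "\<dots> = ennreal ((s / \<delta>) ^ k) * (ennreal ((s / \<delta>) ^ card B) * integral\<^sup>N ?P h)"
        by (subst nn_integral_PiM_lborel_affine[OF fin t]) simp_all
      also have "\<dots> = ennreal ((s / \<delta>) ^ (k + card B)) * integral\<^sup>N ?P h"
        using t by (simp add: power_add ennreal_mult mult.assoc)
      finally show ?thesis using True by simp
    next
      case False
      then show ?thesis by (simp only: slice) (auto simp: indicator_def)
    qed
  qed
  also have "\<dots> = (\<integral>\<^sup>+s. ennreal ((s / \<delta>) ^ (k + card B)) * indicator {0<..<\<delta>} s \<partial>lborel) * integral\<^sup>N ?P h"
    by (rule nn_integral_multc) measurable
  also have "(\<integral>\<^sup>+s. ennreal ((s / \<delta>) ^ (k + card B)) * indicator {0<..<\<delta>} s \<partial>lborel) =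
      (\<integral>\<^sup>+s. ennreal ((s / \<delta>) ^ (k + card B)) * indicator {0..\<delta>} s \<partial>lborel)"
  proof (rule nn_integral_cong_AE)
    show "AE s in lborel. ennreal ((s / \<delta>) ^ (k + card B)) * indicator {0<..<\<delta>} s =
        ennreal ((s / \<delta>) ^ (k + card B)) * indicator {0..\<delta>} s"
      using AE_lborel_singleton[of 0] AE_lborel_singleton[of \<delta>]
      by eventually_elim (auto simp: indicator_def)
  qed
  also have "\<dots> = ennreal (\<delta> / real (k + DIM('a)))"
  proof -
    \<comment> \<open>The slice scaling contributes the exponent \<open>card B\<close>, which is the
      dimension minus one, and homogeneity contributes k. Integrating (s / \<delta>)^m over
      [0, \<delta>] gives \<delta> / (m + 1) with m + 1 equal to \<open>k + DIM('a)\<close>.\<close>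
    let ?m = "k + card B"
    have Suc: "Suc ?m = k + DIM('a)" using cardB DIM_positive[where 'a = 'a] by simp
    let ?F = "\<lambda>s. \<delta> / real (Suc ?m) * (s / \<delta>) ^ Suc ?m"
    have "(\<integral>\<^sup>+s. ennreal ((s / \<delta>) ^ ?m) * indicator {0..\<delta>} s \<partial>lborel) = ennreal (?F \<delta> - ?F 0)"
    proof (rule nn_integral_FTC_Icc)
      fix s :: real assume "s \<in> {0..\<delta>}"
      then show "0 \<le> (s / \<delta>) ^ ?m" by simp
      show "DERIV ?F s :> (s / \<delta>) ^ ?m"
      proof -
        have "DERIV (\<lambda>s. s / \<delta>) s :> 1 / \<delta>"
          using \<delta> by (auto intro!: derivative_eq_intros)
        note D = DERIV_cmult[OF DERIV_power_Suc[OF this, of ?m], of "\<delta> / real (Suc ?m)"]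
        define r where "r = 1 + real ?m"
        have r: "r > 0" "real (Suc ?m) = r" by (simp_all add: r_def)
        show ?thesis
          by (rule DERIV_cong[OF D], unfold r(2) r_def[symmetric]) (use \<delta> r(1) in simp)
      qed
    qed (use \<delta> in auto)
    also have "?F \<delta> - ?F 0 = \<delta> / real (Suc ?m)" using \<delta> by simp
    finally show ?thesis by (simp only: Suc)
  qed
  also have "integral\<^sup>N ?P h = (\<integral>\<^sup>+y\<in>\<sigma>. f y \<partial>affine_lborel ?H)"
    unfolding \<mu> h_def by (rule nn_integral_distr[symmetric]) measurable
  finally show ?thesis .
qed

lemma sets_affine_lborel:
  fixes H :: "'a::euclidean_space set"
  assumes "affine H" "H \<noteq> {}"
  shows "sets (affine_lborel H) = sets borel"
  by (rule affine_lborel_orthonormal[OF assms]) simp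

section \<open>Face integrals recovered from cone integrals of homogeneous functions\<close>

context
  fixes \<sigma> :: "'a::euclidean_space set" and N a :: 'a and \<delta> :: real
  assumes N: "norm N = 1" and \<delta>: "\<delta> > 0"
    and hull: "affine hull \<sigma> = {y. N \<bullet> (y - a) = \<delta>}"
    and \<sigma> [measurable]: "\<sigma> \<in> sets borel"
begin

lemma affine_hull_face_nonempty: "affine hull \<sigma> \<noteq> {}"
proof -
  have "a + \<delta> *\<^sub>R N \<in> affine hull \<sigma>" using N by (simp add: hull dot_square_norm)
  then show ?thesis by blast
qed

lemma sets_affine_lborel_face [measurable_cong]: "sets (affine_lborel (affine hull \<sigma>)) = sets borel"
  by (rule sets_affine_lborel[OF affine_affine_hull affine_hull_face_nonempty])

lemma borel_face_cone [measurable]: "open_cone a \<sigma> \<in> sets borel"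
  by (rule borel_open_cone[OF _ \<delta> \<sigma>]) (use hull hull_subset[of \<sigma> affine] in simp)

text \<open>The absolute value and the positive and negative parts of u are homogeneous of the same
  degree, so the nonnegative formula applies to each; \<open>ennreal\<close> performs the
  truncation. If u is not integrable, both integrals take the default value 0.\<close>

lemma
  assumes u [measurable]: "u \<in> borel_measurable borel"
    and hom: "\<And>t y. 0 < t \<Longrightarrow> u (a + t *\<^sub>R (y - a)) = t ^ k * u y"
  shows set_integrable_open_cone_iff:
      "set_integrable lborel (open_cone a \<sigma>) u \<longleftrightarrow> set_integrable (affine_lborel (affine hull \<sigma>)) \<sigma> u"
    and integral_open_cone: "(LINT x:open_cone a \<sigma>|lborel. u x) =
      \<delta> / real (k + DIM('a)) * (LINT y:\<sigma>|affine_lborel (affine hull \<sigma>). u y)"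
proof -
  let ?C = "open_cone a \<sigma>" and ?\<mu> = "affine_lborel (affine hull \<sigma>)" and ?d = "\<delta> / real (k + DIM('a))"
  have "real (k + DIM('a)) > 0" by (simp only: of_nat_0_less_iff DIM_positive trans_less_add2)
  then have d: "?d > 0" using \<delta> by (rule divide_pos_pos[rotated])
  have eq: "(\<integral>\<^sup>+x\<in>?C. ennreal (g (u x)) \<partial>lborel) = ennreal ?d * (\<integral>\<^sup>+y\<in>\<sigma>. ennreal (g (u y)) \<partial>?\<mu>)"
    if [measurable]: "g \<in> borel_measurable borel" and g: "\<And>r s. r > 0 \<Longrightarrow> g (r * s) = r * g s" for g :: "real \<Rightarrow> real"
  proof (rule nn_integral_open_cone[OF N \<delta> hull \<sigma>])
    show "ennreal (g (u (a + t *\<^sub>R (y - a)))) = ennreal (t ^ k) * ennreal (g (u y))" if "0 < t" for t y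
      using that by (simp only: hom g zero_less_power ennreal_mult' less_imp_le)
  qed measurable
  have split: "(\<integral>\<^sup>+x. ennreal (g (indicator A x *\<^sub>R u x)) \<partial>M) = (\<integral>\<^sup>+x\<in>A. ennreal (g (u x)) \<partial>M)"
    if "g 0 = 0" for g :: "real \<Rightarrow> real" and A and M :: "'a measure"
    using that by (intro nn_integral_cong) (auto simp: indicator_def)
  have "set_integrable lborel ?C u \<longleftrightarrow> (\<integral>\<^sup>+x\<in>?C. ennreal \<bar>u x\<bar> \<partial>lborel) < \<infinity>"
    unfolding set_integrable_def integrable_iff_bounded using split[where g = abs and A = ?C and M = lborel] by simp
  also have "\<dots> \<longleftrightarrow> (\<integral>\<^sup>+y\<in>\<sigma>. ennreal \<bar>u y\<bar> \<partial>?\<mu>) < \<infinity>"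
  proof -
    have "ennreal c * I < \<infinity> \<longleftrightarrow> I < \<infinity>" if "c > 0" for c :: real and I
      using that by (auto simp: ennreal_mult_less_top)
    from this[OF d] show ?thesis by (subst eq[of abs]) (simp_all add: abs_mult)
  qed
  also have "\<dots> \<longleftrightarrow> set_integrable ?\<mu> \<sigma> u"
    unfolding set_integrable_def integrable_iff_bounded using split[where g = abs and A = \<sigma> and M = ?\<mu>] by simp
  finally show *: "set_integrable lborel ?C u \<longleftrightarrow> set_integrable ?\<mu> \<sigma> u" .
  show "(LINT x:?C|lborel. u x) = ?d * (LINT y:\<sigma>|?\<mu>. u y)"
  proof (cases "set_integrable ?\<mu> \<sigma> u")
    case True
    with * have "set_integrable lborel ?C u" by simp
    have lint: "(LINT x:A|M. u x) = enn2real (\<integral>\<^sup>+x\<in>A. ennreal (u x) \<partial>M) - enn2real (\<integral>\<^sup>+x\<in>A. ennreal (- u x) \<partial>M)"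
      if "set_integrable M A u" for A and M :: "'a measure"
      using that unfolding set_integrable_def set_lebesgue_integral_def
      by (simp only: real_lebesgue_integral_def split[where g = "\<lambda>r. r", OF refl] split[where g = uminus, OF minus_zero])
    have "enn2real (ennreal ?d * I) = ?d * enn2real I" for I using d by (simp only: enn2real_mult enn2real_ennreal less_imp_le)
    then show ?thesis
      using eq[of "\<lambda>r. r"] eq[of uminus]
      by (simp only: lint[OF \<open>set_integrable lborel ?C u\<close>] lint[OF True]) (simp add: right_diff_distrib)
  next
    case False
    with * show ?thesis
      by (simp add: set_integrable_def set_lebesgue_integral_def not_integrable_integral_eq)
  qed
qed

lemma emeasure_open_cone:
  "emeasure lborel (open_cone a \<sigma>) = ennreal (\<delta> / real DIM('a)) * emeasure (affine_lborel (affine hull \<sigma>)) \<sigma>"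
  using nn_integral_open_cone[OF N \<delta> hull \<sigma>, of "\<lambda>_. 1" 0] by simp

lemma measure_open_cone: "measure lborel (open_cone a \<sigma>) = \<delta> / real DIM('a) * face_measure \<sigma>"
  using \<delta> by (simp add: measure_def face_measure_def emeasure_open_cone enn2real_mult)

text \<open>The cone formula is read backwards: the cone over a bounded face is bounded, so its
  volume is finite, and dividing by the positive factor \<delta> / d bounds the face
  measure.\<close>

lemma emeasure_face_finite:
  assumes "bounded \<sigma>"
  shows "emeasure (affine_lborel (affine hull \<sigma>)) \<sigma> < \<infinity>"
proof -
  have "bounded (open_cone a \<sigma>)"
  proof -
    obtain r where r: "\<And>y. y \<in> \<sigma> \<Longrightarrow> norm y \<le> r" using assms by (auto simp: bounded_iff)
    have "norm x \<le> norm a + r" if x: "x \<in> open_cone a \<sigma>" for x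
    proof -
      obtain t y where t: "0 < t" "t < 1" "y \<in> \<sigma>" and x_eq: "x = (1 - t) *\<^sub>R a + t *\<^sub>R y"
        using x unfolding open_cone_def by blast
      have "norm x \<le> (1 - t) * norm a + t * norm y"
        unfolding x_eq using t by (intro order_trans[OF norm_triangle_ineq]) simp
      also have "\<dots> \<le> 1 * norm a + 1 * r"
        using t r[OF t(3)] order_trans[OF norm_ge_zero r[OF t(3)]]
        by (intro add_mono mult_mono) auto
      finally show ?thesis by simp
    qed
    then show ?thesis by (auto simp: bounded_iff)
  qed
  then have "emeasure lborel (open_cone a \<sigma>) < \<infinity>" by (rule emeasure_bounded_finite)
  then show ?thesis using \<delta> by (auto simp: emeasure_open_cone ennreal_mult_less_top)
qed

text \<open>The function is homogeneous of degree one about a, which explains the \<open>Suc\<close>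
  in the denominator. Positivity of the face measure lets the normalising factor of
  \<open>face_centroid\<close> be cancelled.\<close>

lemma
  assumes bnd: "bounded \<sigma>" and pos: "face_measure \<sigma> > 0"
  shows set_integrable_open_cone_inner: "set_integrable lborel (open_cone a \<sigma>) (\<lambda>x. v \<bullet> (x - a))"
    and integral_open_cone_inner: "(LINT x:open_cone a \<sigma>|lborel. v \<bullet> (x - a)) =
      \<delta> / real (Suc DIM('a)) * face_measure \<sigma> * (v \<bullet> (face_centroid \<sigma> - a))"
proof -
  let ?\<mu> = "affine_lborel (affine hull \<sigma>)"
  have fin: "emeasure ?\<mu> \<sigma> < \<infinity>" by (rule emeasure_face_finite[OF bnd])
  have int_y: "set_integrable ?\<mu> \<sigma> (\<lambda>y. y)"
  proof -
    obtain r where r: "\<And>y. y \<in> \<sigma> \<Longrightarrow> norm y \<le> r" using bnd by (auto simp: bounded_iff)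
    show ?thesis unfolding set_integrable_def
      by (rule integrableI_bounded_set_indicator[where B = r]) (use fin r in \<open>auto intro!: AE_I2\<close>)
  qed
  have int_c: "set_integrable ?\<mu> \<sigma> (\<lambda>_. c)" for c :: real
    unfolding set_integrable_def using fin by (intro integrable_scaleR_left integrable_real_indicator) simp_all
  have int_v: "set_integrable ?\<mu> \<sigma> (\<lambda>y. v \<bullet> y)"
    using integrable_inner_right[of v, OF int_y[unfolded set_integrable_def]] unfolding set_integrable_def by simp
  have hom: "v \<bullet> (a + t *\<^sub>R (y - a) - a) = t ^ 1 * (v \<bullet> (y - a))" for t y by simp
  note cone = integral_open_cone[OF _ hom] set_integrable_open_cone_iff[OF _ hom]
  have int: "set_integrable ?\<mu> \<sigma> (\<lambda>y. v \<bullet> (y - a))"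
    using set_integral_diff(1)[OF int_v int_c[of "v \<bullet> a"]] by (simp add: inner_diff_right)
  then show "set_integrable lborel (open_cone a \<sigma>) (\<lambda>x. v \<bullet> (x - a))"
    by (subst cone(2)) simp_all
  have "(LINT y:\<sigma>|?\<mu>. v \<bullet> (y - a)) = (LINT y:\<sigma>|?\<mu>. v \<bullet> y) - (LINT y:\<sigma>|?\<mu>. v \<bullet> a)"
    using set_integral_diff(2)[OF int_v int_c[of "v \<bullet> a"]] by (simp add: inner_diff_right)
  also have "(LINT y:\<sigma>|?\<mu>. v \<bullet> y) = v \<bullet> (LINT y:\<sigma>|?\<mu>. y)"
  proof -
    have "(LINT y:\<sigma>|?\<mu>. v \<bullet> y) = (LINT y|?\<mu>. v \<bullet> (indicator \<sigma> y *\<^sub>R y))"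
      unfolding set_lebesgue_integral_def by simp
    also have "\<dots> = v \<bullet> (LINT y:\<sigma>|?\<mu>. y)"
      using int_y unfolding set_integrable_def set_lebesgue_integral_def by (rule integral_inner_right)
    finally show ?thesis .
  qed
  also have "(LINT y:\<sigma>|?\<mu>. y) = face_measure \<sigma> *\<^sub>R face_centroid \<sigma>"
    using pos by (simp add: face_centroid_def)
  also have "(LINT y:\<sigma>|?\<mu>. v \<bullet> a) = face_measure \<sigma> * (v \<bullet> a)"
    unfolding set_lebesgue_integral_def face_measure_def by simp
  finally have "(LINT y:\<sigma>|?\<mu>. v \<bullet> (y - a)) = face_measure \<sigma> * (v \<bullet> (face_centroid \<sigma> - a))"
    by (simp add: algebra_simps)
  then show "(LINT x:open_cone a \<sigma>|lborel. v \<bullet> (x - a)) =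
      \<delta> / real (Suc DIM('a)) * face_measure \<sigma> * (v \<bullet> (face_centroid \<sigma> - a))"
    by (subst cone(1)) simp_all
qed

end

subsection \<open>The gauge of a star-shaped cell\<close>

text \<open>Along the segment from x to y, g is piecewise affine with breakpoints in a finite set,
  so the fundamental theorem of calculus with finitely many exceptional points bounds the increment
  by the largest slope. Convexity plays no part, which is what makes it fit gauges of nonconvex
  cells.\<close>

lemma continuous_affine_selection_lipschitz:
  fixes g :: "'a::real_inner \<Rightarrow> real"
  assumes cont: "continuous_on UNIV g" and fin: "finite I"
    and sel: "\<And>x. \<exists>i\<in>I. g x = m i \<bullet> x + c i" and L: "\<And>i. i \<in> I \<Longrightarrow> norm (m i) \<le> L"
  shows "\<bar>g y - g x\<bar> \<le> L * norm (y - x)"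
proof -
  define f where "f t = g (x + t *\<^sub>R (y - x))" for t
  define A where "A i = m i \<bullet> x + c i" for i
  define B where "B i = m i \<bullet> (y - x)" for i
  have f_sel: "\<exists>i\<in>I. f t = A i + t * B i" for t
    using sel[of "x + t *\<^sub>R (y - x)"] by (auto simp: f_def A_def B_def inner_simps algebra_simps)
  define sl where "sl t = (SOME i. i \<in> I \<and> f t = A i + t * B i)" for t
  have sl: "sl t \<in> I" "f t = A (sl t) + t * B (sl t)" for t
    using someI_ex[OF f_sel[of t, unfolded Bex_def], folded sl_def] by auto
  have cf: "continuous_on T f" for T
    unfolding f_def by (intro continuous_on_compose2[OF cont] continuous_intros) auto
  \<comment> \<open>The parameters at which two of the affine functions cross. For equal slopes,
    division by zero yields 0, which merely adds a harmless exceptional point.\<close>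
  define S where "S = (\<lambda>(i, j). (A j - A i) / (B i - B j)) ` (I \<times> I)"
  have "finite S" using fin by (simp add: S_def)
  have S: "A i = A j \<and> B i = B j" if ij: "i \<in> I" "j \<in> I" and eq: "A i + t * B i = A j + t * B j" and t: "t \<notin> S" for i j t
  proof -
    have "B i = B j"
    proof (rule ccontr)
      assume "B i \<noteq> B j"
      then have "t = (A j - A i) / (B i - B j)" using eq by (simp add: field_simps)
      then show False using t ij by (auto simp: S_def)
    qed
    then show ?thesis using eq by simp
  qed
  have "((\<lambda>t. B (sl t)) has_integral (f 1 - f 0)) {0..1}"
  proof (rule fundamental_theorem_of_calculus_strong[OF \<open>finite S\<close>])
    \<comment> \<open>By continuity, a function inactive at \<open>t\<close> stays inactive nearby,
      so only functions active at \<open>t\<close> can be selected there. Off \<open>S\<close> these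
      coincide along the segment, hence \<open>f\<close> is affine near \<open>t\<close> with slope
      \<open>B (sl t)\<close>.\<close>
    fix t assume "t \<in> {0..1} - S"
    then have t: "t \<notin> S" by simp
    have "\<forall>\<^sub>F s in nhds t. \<forall>j\<in>I. f t \<noteq> A j + t * B j \<longrightarrow> f s \<noteq> A j + s * B j"
      unfolding eventually_ball_finite_distrib[OF fin]
    proof
      fix j
      show "\<forall>\<^sub>F s in nhds t. f t \<noteq> A j + t * B j \<longrightarrow> f s \<noteq> A j + s * B j"
      proof (cases "f t = A j + t * B j")
        case False
        have "isCont (\<lambda>s. f s - (A j + s * B j)) t"
          using cf[of UNIV] by (intro continuous_intros) (simp add: continuous_on_eq_continuous_at)
        then have "((\<lambda>s. f s - (A j + s * B j)) \<longlongrightarrow> f t - (A j + t * B j)) (nhds t)"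
          using tendsto_at_iff_tendsto_nhds[of "\<lambda>s. f s - (A j + s * B j)" t] by (simp add: isCont_def)
        then have "\<forall>\<^sub>F s in nhds t. f s - (A j + s * B j) \<noteq> 0"
          by (rule tendsto_imp_eventually_ne) (use False in simp)
        then show ?thesis by eventually_elim simp
      qed simp
    qed
    then have ev: "\<forall>\<^sub>F s in nhds t. f s = A (sl t) + s * B (sl t)"
    proof eventually_elim
      case (elim s)
      then have "f t = A (sl s) + t * B (sl s)" using sl[of s] by blast
      from trans[OF sym[OF this] sl(2)] have "A (sl s) + t * B (sl s) = A (sl t) + t * B (sl t)" .
      from S[OF sl(1) sl(1) this t] have "A (sl s) = A (sl t)" "B (sl s) = B (sl t)" by auto
      then show ?case by (subst sl(2)) (simp only:)
    qed
    have "((\<lambda>s. A (sl t) + s * B (sl t)) has_real_derivative B (sl t)) (at t)"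
      by (auto intro!: derivative_eq_intros)
    then show "(f has_vector_derivative B (sl t)) (at t)"
      using DERIV_cong_ev[OF refl ev refl] by (simp add: has_real_derivative_iff_has_vector_derivative)
  qed (use cf in auto)
  then have "((\<lambda>t. B (sl t)) has_integral (f 1 - f 0)) (cbox 0 1)" by simp
  then have "norm (f 1 - f 0) \<le> (L * norm (y - x)) * measure lborel (cbox (0::real) 1)"
  proof (rule has_integral_bound[rotated])
    have "B i \<le> L * norm (y - x) \<and> - B i \<le> L * norm (y - x)" if "i \<in> I" for i
    proof -
      have "\<bar>B i\<bar> \<le> norm (m i) * norm (y - x)" unfolding B_def by (rule Cauchy_Schwarz_ineq2)
      also have "\<dots> \<le> L * norm (y - x)" using L[OF that] by (intro mult_right_mono) auto
      finally show ?thesis by (simp only: abs_le_iff)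
    qed
    then show "norm (B (sl t)) \<le> L * norm (y - x)" for t using sl(1)[of t] by (simp add: abs_le_iff)
    have "0 \<le> L" using L[OF sl(1)[of 0]] norm_ge_zero order_trans by blast
    then show "0 \<le> L * norm (y - x)" by simp
  qed
  then show ?thesis by (simp add: f_def)
qed

text \<open>The vector \<open>m \<sigma>\<close> stands for the unit normal divided by the distance
  from a to the face plane. With this scaling every face plane has right-hand side 1, and
  \<open>m \<sigma>\<close> becomes the gradient of the gauge on the cone over \<sigma>.\<close>

locale star_cell =
  fixes K :: "'a::euclidean_space set" and a :: 'a and F :: "'a set set" and m :: "'a set \<Rightarrow> 'a"
  assumes open_K: "open K" and bounded_K: "bounded K" and a_in: "a \<in> K"
    and star: "\<And>y. y \<in> K \<Longrightarrow> closed_segment a y \<subseteq> K"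
    and finite_F: "finite F" and face_sub: "\<And>\<sigma>. \<sigma> \<in> F \<Longrightarrow> \<sigma> \<subseteq> frontier K"
    and face_plane: "\<And>\<sigma> y. \<sigma> \<in> F \<Longrightarrow> y \<in> \<sigma> \<Longrightarrow> m \<sigma> \<bullet> (y - a) = 1"
    and cover: "frontier K \<subseteq> (\<Union>\<sigma>\<in>F. closure \<sigma>)"
    and open_cones: "\<And>\<sigma>. \<sigma> \<in> F \<Longrightarrow> open (open_cone a \<sigma>)"
    and cones: "null_partition F (open_cone a) K"
begin

lemma contract_in: "y \<in> K \<Longrightarrow> 0 \<le> r \<Longrightarrow> r \<le> 1 \<Longrightarrow> a + r *\<^sub>R (y - a) \<in> K"
  using star[of y] by (force simp: closed_segment_def algebra_simps)

lemma closure_face_plane: "\<sigma> \<in> F \<Longrightarrow> y \<in> closure \<sigma> \<Longrightarrow> m \<sigma> \<bullet> (y - a) = 1"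
proof -
  assume "\<sigma> \<in> F" "y \<in> closure \<sigma>"
  moreover have "closure \<sigma> \<subseteq> {y. m \<sigma> \<bullet> (y - a) = 1}"
    using face_plane[OF \<open>\<sigma> \<in> F\<close>] by (intro closure_minimal closed_Collect_eq) (auto intro!: continuous_intros)
  ultimately show ?thesis by auto
qed

lemma frontier_plane: "y \<in> frontier K \<Longrightarrow> \<exists>\<sigma>\<in>F. m \<sigma> \<bullet> (y - a) = 1"
  using cover closure_face_plane by blast

text \<open>A ray from \<open>a\<close> meets each face hyperplane at most once, so it cannot run inside the frontier.\<close>

lemma contract_closure_in:
  assumes y: "y \<in> closure K" and r: "0 \<le> r" "r < 1"
  shows "a + r *\<^sub>R (y - a) \<in> K"
proof (rule ccontr)
  assume out: "a + r *\<^sub>R (y - a) \<notin> K"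
  \<comment> \<open>If the point at parameter \<open>r\<close> lies outside K, then by
    star-shapedness so does every later point of the ray. Those with \<open>r < s < 1\<close> are
    frontier points, which forces the infinitely many values 1 / s into a finite set.\<close>
  have "(1 / s) \<in> (\<lambda>\<sigma>. m \<sigma> \<bullet> (y - a)) ` F" if s: "s \<in> {r<..<1}" for s
  proof -
    let ?z = "a + s *\<^sub>R (y - a)"
    have "(\<lambda>y. a + s *\<^sub>R (y - a)) ` closure K \<subseteq> closure K"
      using s r contract_in by (intro image_closure_subset continuous_intros) (auto intro!: subsetD[OF closure_subset])
    then have "?z \<in> closure K" using y by blast
    moreover have "?z \<notin> K"
    proof
      assume "?z \<in> K"
      from contract_in[OF this, of "r / s"] have "a + r *\<^sub>R (y - a) \<in> K" using s r by simp
      with out show False by simp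
    qed
    ultimately have "?z \<in> frontier K" using open_K by (simp add: frontier_def interior_open)
    then obtain \<sigma> where "\<sigma> \<in> F" "m \<sigma> \<bullet> (?z - a) = 1" using frontier_plane by blast
    then have "s * (m \<sigma> \<bullet> (y - a)) = 1" by (simp only: add_diff_cancel_left' inner_scaleR_right)
    then have "m \<sigma> \<bullet> (y - a) = 1 / s" using s r by (simp add: field_simps)
    then show ?thesis using \<open>\<sigma> \<in> F\<close> by (auto intro!: image_eqI[of _ _ \<sigma>])
  qed
  then have "(\<lambda>s. 1 / s) ` {r<..<1} \<subseteq> (\<lambda>\<sigma>. m \<sigma> \<bullet> (y - a)) ` F" by blast
  then have "finite ((\<lambda>s. 1 / s) ` {r<..<1})" using finite_F by (blast intro: finite_subset)
  moreover have "inj_on (\<lambda>s. 1 / s) {r<..<1}" by (auto simp: inj_on_def)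
  ultimately have "finite {r<..<1}" by (simp add: finite_image_iff)
  then show False using r by (simp add: infinite_Ioo)
qed

definition radial_gauge :: "'a \<Rightarrow> real" where
  "radial_gauge x = Inf {s. s > 0 \<and> a + (1 / s) *\<^sub>R (x - a) \<in> K}"

lemma ex_scaling_in_cell: "\<exists>s>0. a + (1 / s) *\<^sub>R (x - a) \<in> K"
proof -
  have "((\<lambda>s. a + (1 / s) *\<^sub>R (x - a)) \<longlongrightarrow> a + 0 *\<^sub>R (x - a)) at_top"
    by (intro tendsto_intros tendsto_divide_0[OF tendsto_const] filterlim_at_top_imp_at_infinity filterlim_ident)
  then have "\<forall>\<^sub>F s in at_top. a + (1 / s) *\<^sub>R (x - a) \<in> K"
    using open_K a_in by (intro topological_tendstoD) auto
  then have "\<forall>\<^sub>F s in at_top. s > 0 \<and> a + (1 / s) *\<^sub>R (x - a) \<in> K"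
    using eventually_gt_at_top[of 0] by eventually_elim simp
  then show ?thesis by (auto dest: eventually_happens'[rotated])
qed

text \<open>Star-shapedness makes the admissible scalings upward closed, and openness of K lets any
  of them be decreased slightly. The infimum is therefore never attained, which gives the strict
  inequality.\<close>

lemma radial_gauge_less_iff:
  assumes s: "s > 0"
  shows "radial_gauge x < s \<longleftrightarrow> a + (1 / s) *\<^sub>R (x - a) \<in> K"
proof
  let ?S = "{s. s > 0 \<and> a + (1 / s) *\<^sub>R (x - a) \<in> K}"
  have bdd: "bdd_below ?S" by (auto intro: bdd_belowI[of _ 0])
  {
    assume "radial_gauge x < s"
    then obtain t where t: "t > 0" "a + (1 / t) *\<^sub>R (x - a) \<in> K" "t < s"
      using ex_scaling_in_cell[of x] by (auto simp: radial_gauge_def cInf_less_iff[OF _ bdd] ex_in_conv[symmetric])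
    from contract_in[OF t(2), of "t / s"] show "a + (1 / s) *\<^sub>R (x - a) \<in> K" using t by simp
  next
    assume "a + (1 / s) *\<^sub>R (x - a) \<in> K"
    moreover have "((\<lambda>t. a + (1 / t) *\<^sub>R (x - a)) \<longlongrightarrow> a + (1 / s) *\<^sub>R (x - a)) (at_left s)"
      using s by (intro tendsto_intros) auto
    ultimately have "\<forall>\<^sub>F t in at_left s. a + (1 / t) *\<^sub>R (x - a) \<in> K"
      using open_K by (intro topological_tendstoD) auto
    moreover have "\<forall>\<^sub>F t in at_left s. t \<in> {0<..<s}" using s by (rule eventually_at_left_real)
    ultimately have "\<forall>\<^sub>F t in at_left s. t \<in> ?S \<and> t < s" by eventually_elim simp
    then obtain t where "t \<in> ?S" "t < s" by (auto dest: eventually_happens'[rotated])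
    then show "radial_gauge x < s" unfolding radial_gauge_def using cInf_lower[OF _ bdd] by force
  }
qed

lemma radial_gauge_nonneg: "radial_gauge x \<ge> 0"
  unfolding radial_gauge_def using ex_scaling_in_cell[of x] by (intro cInf_greatest) auto

text \<open>The backward direction is where \<open>contract_closure_in\<close> is indispensable: for
  a disc with a radial slit removed, the closure contains the slit although the gauge there is too
  large.\<close>

lemma radial_gauge_le_iff:
  assumes s: "s > 0"
  shows "radial_gauge x \<le> s \<longleftrightarrow> a + (1 / s) *\<^sub>R (x - a) \<in> closure K"
proof
  assume "radial_gauge x \<le> s"
  have "((\<lambda>t. a + (1 / t) *\<^sub>R (x - a)) \<longlongrightarrow> a + (1 / s) *\<^sub>R (x - a)) (at_right s)"
    using s by (intro tendsto_intros) auto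
  moreover have "\<forall>\<^sub>F t in at_right s. a + (1 / t) *\<^sub>R (x - a) \<in> closure K"
    using eventually_at_right_less[of s]
  proof eventually_elim
    case (elim t)
    then have "a + (1 / t) *\<^sub>R (x - a) \<in> K" using radial_gauge_less_iff[of t x] s \<open>radial_gauge x \<le> s\<close> by simp
    then show ?case using closure_subset by blast
  qed
  ultimately show "a + (1 / s) *\<^sub>R (x - a) \<in> closure K"
    by (intro Lim_in_closed_set[OF closed_closure]) auto
next
  assume y: "a + (1 / s) *\<^sub>R (x - a) \<in> closure K"
  show "radial_gauge x \<le> s"
  proof (rule dense_ge)
    fix t assume "s < t"
    then have "a + (1 / t) *\<^sub>R (x - a) \<in> K"
      using contract_closure_in[OF y, of "s / t"] s by simp
    then show "radial_gauge x \<le> t" using radial_gauge_less_iff[of t x] s \<open>s < t\<close> by simp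
  qed
qed

text \<open>Upper semicontinuity comes from openness of K, lower semicontinuity from openness of the
  complement of its closure.\<close>

lemma continuous_radial_gauge: "continuous_on UNIV radial_gauge"
  unfolding continuous_on_eq_continuous_at[OF open_UNIV] isCont_def
proof (intro ballI order_tendstoI)
  fix x s assume *: "radial_gauge x < s"
  then have s: "s > 0" using radial_gauge_nonneg[of x] by simp
  have "((\<lambda>y. a + (1 / s) *\<^sub>R (y - a)) \<longlongrightarrow> a + (1 / s) *\<^sub>R (x - a)) (at x)"
    by (intro tendsto_intros)
  then have "\<forall>\<^sub>F y in at x. a + (1 / s) *\<^sub>R (y - a) \<in> K"
    using open_K * radial_gauge_less_iff[OF s, of x] by (intro topological_tendstoD) auto
  then show "\<forall>\<^sub>F y in at x. radial_gauge y < s" by (simp add: radial_gauge_less_iff[OF s])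
next
  fix x s assume "s < radial_gauge x"
  \<comment> \<open>The closure criterion applies to positive levels only, and \<open>s\<close> may
    be 0; an intermediate level covers that case.\<close>
  then obtain s' where s': "s < s'" "s' < radial_gauge x" using dense by blast
  show "\<forall>\<^sub>F y in at x. s < radial_gauge y"
  proof (cases "s' > 0")
    case True
    have "((\<lambda>y. a + (1 / s') *\<^sub>R (y - a)) \<longlongrightarrow> a + (1 / s') *\<^sub>R (x - a)) (at x)"
      by (intro tendsto_intros)
    then have "\<forall>\<^sub>F y in at x. a + (1 / s') *\<^sub>R (y - a) \<in> - closure K"
      using s' radial_gauge_le_iff[OF True, of x] by (intro topological_tendstoD) (auto simp: open_Compl)
    then show ?thesis by eventually_elim (use s' radial_gauge_le_iff[OF True] in force)
  next
    case False
    then have "s < radial_gauge y" for y using radial_gauge_nonneg[of y] s' by linarith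
    then show ?thesis by simp
  qed
qed

text \<open>Dividing x - a by a positive gauge value lands on the frontier, and the plane equation
  of a face there scales back to the claim. Boundedness of K forces x = a when the gauge is 0, and
  then any face serves.\<close>

lemma radial_gauge_selection: "\<exists>\<sigma>\<in>F. radial_gauge x = m \<sigma> \<bullet> (x - a)"
proof (cases "radial_gauge x = 0")
  case True
  have "x = a"
  proof (rule ccontr)
    assume "x \<noteq> a"
    obtain R where R: "\<And>y. y \<in> K \<Longrightarrow> norm (y - a) \<le> R"
      using bounded_translation[OF bounded_K, of "-a"] by (auto simp: bounded_iff add.commute)
    have "R \<ge> 0" using R[OF a_in] by simp
    \<comment> \<open>Chosen so that the rescaled point has distance R + 1 from a, beyond the bound
      R for K.\<close>
    let ?s = "norm (x - a) / (R + 1)"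
    have s: "?s > 0" using \<open>x \<noteq> a\<close> \<open>R \<ge> 0\<close> by simp
    then have "a + (1 / ?s) *\<^sub>R (x - a) \<in> K" using radial_gauge_less_iff[OF s, of x] True by simp
    from R[OF this] show False using \<open>x \<noteq> a\<close> \<open>R \<ge> 0\<close> by simp
  qed
  moreover have "F \<noteq> {}"
  proof -
    have "frontier K \<noteq> {}" using a_in bounded_K not_bounded_UNIV by (subst frontier_eq_empty) blast
    then show ?thesis using cover by auto
  qed
  ultimately show ?thesis using True by auto
next
  case False
  then have g: "radial_gauge x > 0" using radial_gauge_nonneg[of x] by simp
  let ?y = "a + (1 / radial_gauge x) *\<^sub>R (x - a)"
  have "?y \<in> frontier K"
    using radial_gauge_less_iff[OF g, of x] radial_gauge_le_iff[OF g, of x] open_K by (simp add: frontier_def interior_open)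
  then obtain \<sigma> where "\<sigma> \<in> F" "m \<sigma> \<bullet> (?y - a) = 1" using frontier_plane by blast
  then have "1 / radial_gauge x * (m \<sigma> \<bullet> (x - a)) = 1" by (simp only: add_diff_cancel_left' inner_scaleR_right)
  then show ?thesis using g \<open>\<sigma> \<in> F\<close> by (intro bexI[of _ \<sigma>]) (simp_all add: field_simps)
qed

lemma radial_gauge_lipschitz: "\<exists>L\<ge>0. \<forall>x y. \<bar>radial_gauge y - radial_gauge x\<bar> \<le> L * norm (y - x)"
proof (intro exI conjI allI)
  \<comment> \<open>The sum is a crude common bound for the norms of the finitely many
    gradients.\<close>
  show "0 \<le> (\<Sum>\<sigma>\<in>F. norm (m \<sigma>))" by (intro sum_nonneg) auto
  fix x y
  show "\<bar>radial_gauge y - radial_gauge x\<bar> \<le> (\<Sum>\<sigma>\<in>F. norm (m \<sigma>)) * norm (y - x)"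
  proof (rule continuous_affine_selection_lipschitz[OF continuous_radial_gauge finite_F])
    show "\<exists>\<sigma>\<in>F. radial_gauge x = m \<sigma> \<bullet> x + (- m \<sigma> \<bullet> a)" for x
      using radial_gauge_selection[of x] by (auto simp: inner_diff_right)
    show "norm (m \<sigma>) \<le> (\<Sum>\<sigma>\<in>F. norm (m \<sigma>))" if "\<sigma> \<in> F" for \<sigma>
      using that finite_F by (intro member_le_sum) auto
  qed
qed

text \<open>A point at fraction t of the way from a to y in \<sigma> has gauge t, because y is in
  the closure of K but not in K; the linear function also takes the value t there.\<close>

lemma radial_gauge_cone:
  assumes \<sigma>: "\<sigma> \<in> F" and x: "x \<in> open_cone a \<sigma>"
  shows "radial_gauge x = m \<sigma> \<bullet> (x - a)"
proof -
  obtain t y where t: "0 < t" "t < 1" and y: "y \<in> \<sigma>" and x_eq: "x = (1 - t) *\<^sub>R a + t *\<^sub>R y"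
    using x unfolding open_cone_def by blast
  have xa: "x - a = t *\<^sub>R (y - a)" by (simp add: x_eq algebra_simps)
  have "y \<in> frontier K" using face_sub[OF \<sigma>] y by blast
  then have "y \<in> closure K" "y \<notin> K" using open_K by (simp_all add: frontier_def interior_open)
  then have "radial_gauge x = t"
    using radial_gauge_less_iff[OF t(1), of x] radial_gauge_le_iff[OF t(1), of x] t by (simp add: xa)
  then show ?thesis using face_plane[OF \<sigma> y] by (simp add: xa)
qed

lemma radial_gauge_less_1_iff: "radial_gauge x < 1 \<longleftrightarrow> x \<in> K"
  using radial_gauge_less_iff[of 1 x] by simp

end

subsection \<open>The divergence theorem on a cell\<close>

lemma integral_lborel_translate:
  fixes f :: "'a::euclidean_space \<Rightarrow> real"
  assumes [measurable]: "f \<in> borel_measurable borel"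
  shows "(LINT x|lborel. f (a + x)) = (LINT x|lborel. f x)"
proof -
  have "(LINT x|lborel. f x) = (LINT x|distr lborel borel ((+) a). f x)"
    by (simp only: lborel_distr_plus)
  also have "\<dots> = (LINT x|lborel. f (a + x))" by (subst integral_distr) simp_all
  finally show ?thesis ..
qed

lemma integrable_lborel_bounded_support:
  fixes f :: "'a::euclidean_space \<Rightarrow> real"
  assumes [measurable]: "f \<in> borel_measurable borel"
    and supp: "\<And>x. norm x > R \<Longrightarrow> f x = 0" and bd: "\<And>x. \<bar>f x\<bar> \<le> C"
  shows "integrable lborel f"
proof (rule Bochner_Integration.integrable_bound)
  show "integrable lborel (\<lambda>x. C * indicator (cball 0 R) x :: real)"
    using emeasure_lborel_cball_finite by (intro integrable_mult_right integrable_real_indicator) auto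
  show "AE x in lborel. norm (f x) \<le> norm (C * indicator (cball 0 R) x)"
    using supp bd by (intro AE_I2) (auto simp: indicator_def intro: order_trans[OF _ abs_ge_self])
qed simp

text \<open>Each difference quotient has integral zero by translation invariance. The Lipschitz
  bound and the bounded support dominate the quotients, so the integral passes to their almost
  everywhere limit.\<close>

lemma integral_derivative_bounded_support:
  fixes f :: "'a::euclidean_space \<Rightarrow> real"
  assumes cont: "continuous_on UNIV f"
    and supp: "\<And>x. norm x > R \<Longrightarrow> f x = 0"
    and lip: "\<And>x h. \<bar>h\<bar> \<le> 1 \<Longrightarrow> \<bar>f (x + h *\<^sub>R v) - f x\<bar> \<le> C * \<bar>h\<bar>"
    and q [measurable]: "q \<in> borel_measurable borel"
    and der: "AE x in lborel. ((\<lambda>h. f (x + h *\<^sub>R v)) has_real_derivative q x) (at 0)"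
  shows "(LINT x|lborel. q x) = 0"
proof -
  have [measurable]: "f \<in> borel_measurable borel" using cont by (rule borel_measurable_continuous_onI)
  \<comment> \<open>Steps of size at most 1 stay within the range of the Lipschitz hypothesis and
    keep all shifted supports in the ball of radius \<open>R + norm v\<close>.\<close>
  define e where "e n = 1 / real (Suc n)" for n
  have e: "e n > 0" "e n \<le> 1" for n by (simp_all add: e_def divide_simps)
  have e_lim: "e \<longlonglongrightarrow> 0" unfolding e_def using LIMSEQ_inverse_real_of_nat by (simp add: inverse_eq_divide)
  define p where "p n x = (f (x + e n *\<^sub>R v) - f x) / e n" for n x
  have [measurable]: "p n \<in> borel_measurable borel" for n unfolding p_def by measurable
  have bnd_f: "\<exists>B. \<forall>x. \<bar>f x\<bar> \<le> B"
  proof -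
    have "bounded (f ` cball 0 R)"
      using cont by (intro compact_imp_bounded compact_continuous_image) (auto intro: continuous_on_subset)
    then obtain B where "\<forall>y\<in>f ` cball 0 R. norm y \<le> B" unfolding bounded_iff by blast
    then have B: "\<bar>f x\<bar> \<le> B" if "x \<in> cball 0 R" for x using that by simp
    have "\<bar>f x\<bar> \<le> max 0 B" for x
    proof (cases "norm x > R")
      case False
      then show ?thesis using B[of x] by (simp add: max.coboundedI2)
    qed (simp add: supp)
    then show ?thesis by blast
  qed
  then obtain B where B: "\<And>x. \<bar>f x\<bar> \<le> B" by blast
  have int_f: "integrable lborel f" by (rule integrable_lborel_bounded_support[OF _ supp B]) simp_all
  have p0: "(LINT x|lborel. p n x) = 0" for n
  proof -
    have int: "integrable lborel (\<lambda>x. f (x + e n *\<^sub>R v))"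
    proof (rule integrable_lborel_bounded_support[where R = "R + norm v" and C = B])
      fix x :: 'a assume "norm x > R + norm v"
      moreover have "norm x \<le> norm (x + e n *\<^sub>R v) + norm (e n *\<^sub>R v)"
        using norm_triangle_ineq4[of "x + e n *\<^sub>R v" "e n *\<^sub>R v"] by simp
      moreover have "norm (e n *\<^sub>R v) \<le> norm v"
        using e[of n] by (simp add: mult_left_le_one_le)
      ultimately show "f (x + e n *\<^sub>R v) = 0" by (intro supp) simp
    qed (simp_all add: B)
    have "(LINT x|lborel. p n x) = ((LINT x|lborel. f (x + e n *\<^sub>R v)) - (LINT x|lborel. f x)) / e n"
      unfolding p_def using int int_f by simp
    also have "(LINT x|lborel. f (x + e n *\<^sub>R v)) = (LINT x|lborel. f x)"
      using integral_lborel_translate[of f "e n *\<^sub>R v"] by (simp add: add.commute)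
    finally show ?thesis by simp
  qed
  have "(\<lambda>n. LINT x|lborel. p n x) \<longlonglongrightarrow> (LINT x|lborel. q x)"
  proof (rule integral_dominated_convergence)
    show "integrable lborel (\<lambda>x. C * indicator (cball 0 (R + norm v)) x :: real)"
      using emeasure_lborel_cball_finite by (intro integrable_mult_right integrable_real_indicator) auto
    show "AE x in lborel. (\<lambda>n. p n x) \<longlonglongrightarrow> q x"
      using der
    proof eventually_elim
      case (elim x)
      then have "((\<lambda>h. (f (x + h *\<^sub>R v) - f x) / h) \<longlongrightarrow> q x) (at 0)"
        by (simp add: DERIV_def)
      moreover have "filterlim e (at 0) sequentially"
        using e_lim e(1) by (auto simp: filterlim_at less_imp_neq[THEN not_sym])
      ultimately show ?case unfolding p_def by (rule filterlim_compose)
    qed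
    show "AE x in lborel. norm (p n x) \<le> C * indicator (cball 0 (R + norm v)) x" for n
    proof (rule AE_I2)
      fix x
      have "\<bar>p n x\<bar> \<le> C"
        using lip[of "e n" x] e[of n] by (simp add: p_def abs_divide pos_divide_le_eq)
      moreover have "p n x = 0" if "norm x > R + norm v"
      proof -
        have "norm x \<le> norm (x + e n *\<^sub>R v) + norm (e n *\<^sub>R v)"
          using norm_triangle_ineq4[of "x + e n *\<^sub>R v" "e n *\<^sub>R v"] by simp
        moreover have "norm (e n *\<^sub>R v) \<le> norm v"
          using e[of n] by (simp add: mult_left_le_one_le)
        ultimately have "f (x + e n *\<^sub>R v) = 0" using that by (intro supp) simp
        moreover have "f x = 0" using that norm_ge_zero[of v] by (intro supp) linarith
        ultimately show ?thesis by (simp add: p_def)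
      qed
      ultimately show "norm (p n x) \<le> C * indicator (cball 0 (R + norm v)) x"
        by (auto simp: indicator_def)
    qed
  qed simp_all
  then show ?thesis using p0 by (simp add: LIMSEQ_const_iff)
qed

context star_cell
begin

lemma cone_subset: "\<sigma> \<in> F \<Longrightarrow> open_cone a \<sigma> \<subseteq> K"
  using cones by (auto simp: null_partition_def)

lemma cones_disjoint: "\<sigma> \<in> F \<Longrightarrow> \<tau> \<in> F \<Longrightarrow> x \<in> open_cone a \<sigma> \<Longrightarrow> x \<in> open_cone a \<tau> \<Longrightarrow> \<sigma> = \<tau>"
  using cones by (auto simp: null_partition_def disjoint_family_on_def)

lemma sum_indicator_cone:
  assumes "\<sigma> \<in> F" "x \<in> open_cone a \<sigma>"
  shows "(\<Sum>\<tau>\<in>F. indicator (open_cone a \<tau>) x * f \<tau>) = (f \<sigma> :: real)"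
proof -
  have "(\<Sum>\<tau>\<in>F. indicator (open_cone a \<tau>) x * f \<tau>) = (\<Sum>\<tau>\<in>F. if \<tau> = \<sigma> then f \<sigma> else 0)"
    using assms cones_disjoint by (intro sum.cong refl) (auto simp: indicator_def)
  then show ?thesis using finite_F assms by simp
qed

text \<open>The exceptional points lie on the frontier, which is contained in finitely many
  hyperplanes, or in the null part of K missed by the cones. A face with
  \<open>m \<sigma> = 0\<close> would satisfy 0 = 1 at each of its points, so it is empty.\<close>

lemma AE_cone_or_exterior:
  "AE x in lborel. (\<exists>\<sigma>\<in>F. x \<in> open_cone a \<sigma>) \<or> x \<notin> closure K"
proof -
  have "negligible (closure \<sigma>)" if \<sigma>: "\<sigma> \<in> F" for \<sigma>
  proof (cases "m \<sigma> = 0")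
    case False
    have "closure \<sigma> \<subseteq> {y. m \<sigma> \<bullet> y = 1 + m \<sigma> \<bullet> a}"
      using closure_face_plane[OF \<sigma>] by (auto simp: inner_diff_right algebra_simps)
    then show ?thesis using negligible_hyperplane[of "m \<sigma>"] False negligible_subset by blast
  next
    case True
    then have "\<sigma> = {}" using face_plane[OF \<sigma>] by auto
    then show ?thesis by simp
  qed
  then have "negligible (\<Union>\<sigma>\<in>F. closure \<sigma>)" using finite_F by (intro negligible_Union) auto
  then have "negligible (frontier K)" using cover negligible_subset by blast
  moreover have "negligible (K - (\<Union>\<sigma>\<in>F. open_cone a \<sigma>))" using cones by (simp add: null_partition_def)
  ultimately have "negligible (frontier K \<union> (K - (\<Union>\<sigma>\<in>F. open_cone a \<sigma>)))" by (rule negligible_Un)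
  then have "AE x in lebesgue. x \<notin> frontier K \<union> (K - (\<Union>\<sigma>\<in>F. open_cone a \<sigma>))"
    unfolding negligible_iff_null_sets by (rule AE_not_in)
  then have "AE x in lebesgue. (\<exists>\<sigma>\<in>F. x \<in> open_cone a \<sigma>) \<or> x \<notin> closure K"
    by eventually_elim (use open_K in \<open>auto simp: frontier_def interior_open\<close>)
  then show ?thesis by (simp add: AE_completion_iff)
qed

text \<open>The Lipschitz function \<open>max 0 (1 - radial_gauge x) * (w \<bullet> (x - a))\<close> vanishes outside \<open>K\<close>, so its derivative
  in the direction \<open>v\<close> has integral zero; this derivative is explicit on each cone.\<close>

lemma sum_cone_integrals_eq_0:
  assumes int: "\<And>\<sigma> u. \<sigma> \<in> F \<Longrightarrow> set_integrable lborel (open_cone a \<sigma>) (\<lambda>x. u \<bullet> (x - a))"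
  shows "(\<Sum>\<sigma>\<in>F. (v \<bullet> w) * (measure lborel (open_cone a \<sigma>) - (LINT x:open_cone a \<sigma>|lborel. m \<sigma> \<bullet> (x - a))) -
    (m \<sigma> \<bullet> v) * (LINT x:open_cone a \<sigma>|lborel. w \<bullet> (x - a))) = 0"
proof -
  obtain L where L: "L \<ge> 0" "\<And>x y. \<bar>radial_gauge y - radial_gauge x\<bar> \<le> L * norm (y - x)"
    using radial_gauge_lipschitz by blast
  obtain R0 where R0: "\<And>x. x \<in> K \<Longrightarrow> norm x \<le> R0" using bounded_K by (auto simp: bounded_iff)
  define u where "u x = max 0 (1 - radial_gauge x)" for x
  define f where "f x = u x * (w \<bullet> (x - a))" for x
  have u01: "0 \<le> u x" "u x \<le> 1" for x using radial_gauge_nonneg[of x] by (auto simp: u_def)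
  have u_lip: "\<bar>u y - u x\<bar> \<le> L * norm (y - x)" for x y
    using L(2)[where x = x and y = y] unfolding u_def by linarith
  have u_out: "u x = 0" if "x \<notin> K" for x using that radial_gauge_less_1_iff[of x] by (simp add: u_def)
  \<comment> \<open>The derivative at h = 0 of (1 - m.(x + h v - a)) (w.(x + h v - a)), where m
    stands for \<open>m \<sigma>\<close>.\<close>
  define r where "r x \<sigma> = (1 - m \<sigma> \<bullet> (x - a)) * (v \<bullet> w) - (m \<sigma> \<bullet> v) * (w \<bullet> (x - a))" for x \<sigma>
  have r_int: "set_integrable lborel (open_cone a \<sigma>) (\<lambda>x. r x \<sigma>)"
    "(LINT x:open_cone a \<sigma>|lborel. r x \<sigma>) =
      (v \<bullet> w) * (measure lborel (open_cone a \<sigma>) - (LINT x:open_cone a \<sigma>|lborel. m \<sigma> \<bullet> (x - a))) -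
      (m \<sigma> \<bullet> v) * (LINT x:open_cone a \<sigma>|lborel. w \<bullet> (x - a))" if \<sigma>: "\<sigma> \<in> F" for \<sigma>
  proof -
    let ?C = "open_cone a \<sigma>"
    have "emeasure lborel ?C < \<infinity>"
      using bounded_subset[OF bounded_K cone_subset[OF \<sigma>]] by (rule emeasure_bounded_finite)
    then have 1: "set_integrable lborel ?C (\<lambda>_. 1 :: real)"
      unfolding set_integrable_def using open_cones[OF \<sigma>] by simp
    have r_eq: "r x \<sigma> = (v \<bullet> w) * (1 - m \<sigma> \<bullet> (x - a)) - (m \<sigma> \<bullet> v) * (w \<bullet> (x - a))" for x
      by (simp add: r_def)
    note d = set_integral_diff[OF 1 int[OF \<sigma>, of "m \<sigma>"]]
    note d1 = set_integrable_mult_right[of "v \<bullet> w", OF d(1)] set_integrable_mult_right[of "m \<sigma> \<bullet> v", OF int[OF \<sigma>, of w]]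
    note d2 = set_integral_diff[OF d1]
    show "set_integrable lborel ?C (\<lambda>x. r x \<sigma>)" unfolding r_eq by (rule d2)
    have "(LINT x:?C|lborel. 1) = measure lborel ?C"
      by (simp add: set_lebesgue_integral_def)
    then show "(LINT x:?C|lborel. r x \<sigma>) =
      (v \<bullet> w) * (measure lborel ?C - (LINT x:?C|lborel. m \<sigma> \<bullet> (x - a))) -
      (m \<sigma> \<bullet> v) * (LINT x:?C|lborel. w \<bullet> (x - a))"
      unfolding r_eq d2(2) set_integral_mult_right d(2) by simp
  qed
  define q where "q x = (\<Sum>\<sigma>\<in>F. indicator (open_cone a \<sigma>) x * r x \<sigma>)" for x
  have "(LINT x|lborel. q x) = 0"
  proof (rule integral_derivative_bounded_support)
    show "continuous_on UNIV f"
      unfolding f_def u_def by (intro continuous_intros continuous_radial_gauge)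
    show "f x = 0" if "R0 < norm x" for x
      using R0[of x] u_out[of x] that by (auto simp: f_def)
    \<comment> \<open>A bound for |w.(x - a)| as soon as x or x + h v lies in K; the extra
      \<open>norm v\<close> covers the second possibility.\<close>
    let ?W = "norm w * (R0 + norm v + norm a)"
    show "\<bar>f (x + h *\<^sub>R v) - f x\<bar> \<le> (L * norm v * ?W + norm v * norm w) * \<bar>h\<bar>" if h: "\<bar>h\<bar> \<le> 1" for x h
    proof (cases "x \<in> K \<or> x + h *\<^sub>R v \<in> K")
      case False
      have "0 \<le> R0" using R0[OF a_in] norm_ge_zero order_trans by blast
      then show ?thesis using False u_out L(1) by (simp add: f_def)
    next
      case True
      have hv: "norm (h *\<^sub>R v) \<le> norm v" using h by (simp add: mult_left_le_one_le)
      have "norm x \<le> R0 + norm v"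
      proof (cases "x \<in> K")
        case True
        then show ?thesis using R0[of x] norm_ge_zero[of v] by linarith
      next
        case False
        with \<open>x \<in> K \<or> x + h *\<^sub>R v \<in> K\<close> have "norm (x + h *\<^sub>R v) \<le> R0" using R0 by blast
        then show ?thesis using norm_triangle_ineq4[of "x + h *\<^sub>R v" "h *\<^sub>R v"] hv by simp
      qed
      then have "norm (x - a) \<le> R0 + norm v + norm a" using norm_triangle_ineq4[of x a] by linarith
      then have W: "\<bar>w \<bullet> (x - a)\<bar> \<le> ?W"
        using Cauchy_Schwarz_ineq2[of w "x - a"] by (meson mult_left_mono norm_ge_zero order_trans)
      \<comment> \<open>In this splitting the increment of \<open>u\<close> meets the factor bounded
        by \<open>?W\<close>, and the increment of the linear factor meets \<open>u\<close>, which
        is at most 1.\<close>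
      have "f (x + h *\<^sub>R v) - f x = (u (x + h *\<^sub>R v) - u x) * (w \<bullet> (x - a)) + u (x + h *\<^sub>R v) * (h * (w \<bullet> v))"
        by (simp add: f_def inner_simps algebra_simps)
      also have "\<bar>\<dots>\<bar> \<le> \<bar>u (x + h *\<^sub>R v) - u x\<bar> * \<bar>w \<bullet> (x - a)\<bar> + \<bar>u (x + h *\<^sub>R v)\<bar> * (\<bar>h\<bar> * \<bar>w \<bullet> v\<bar>)"
        by (rule order_trans[OF abs_triangle_ineq]) (simp add: abs_mult)
      also have "\<dots> \<le> (L * (\<bar>h\<bar> * norm v)) * ?W + 1 * (\<bar>h\<bar> * (norm w * norm v))"
        using u_lip[of "x + h *\<^sub>R v" x] W u01[of "x + h *\<^sub>R v"] L(1) Cauchy_Schwarz_ineq2[of w v]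
        by (intro add_mono mult_mono) auto
      finally show ?thesis by (simp add: algebra_simps)
    qed
    show "q \<in> borel_measurable borel"
      unfolding q_def r_def
      by (intro borel_measurable_sum borel_measurable_times borel_measurable_indicator borel_open open_cones) simp_all
    show "AE x in lborel. ((\<lambda>h. f (x + h *\<^sub>R v)) has_real_derivative q x) (at 0)"
      using AE_cone_or_exterior
    proof eventually_elim
      case (elim x)
      have lim: "((\<lambda>h. x + h *\<^sub>R v) \<longlongrightarrow> x + 0 *\<^sub>R v) (nhds 0)" by (intro tendsto_intros filterlim_ident)
      from elim show ?case
      proof
        assume "\<exists>\<sigma>\<in>F. x \<in> open_cone a \<sigma>"
        then obtain \<sigma> where \<sigma>: "\<sigma> \<in> F" and x: "x \<in> open_cone a \<sigma>" by blast
        have "\<forall>\<^sub>F h in nhds 0. x + h *\<^sub>R v \<in> open_cone a \<sigma>"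
          using lim open_cones[OF \<sigma>] x by (intro topological_tendstoD) auto
        then have ev: "\<forall>\<^sub>F h in nhds 0. f (x + h *\<^sub>R v) =
            (1 - m \<sigma> \<bullet> (x - a) - h * (m \<sigma> \<bullet> v)) * (w \<bullet> (x - a) + h * (w \<bullet> v))"
        proof eventually_elim
          case (elim h)
          moreover have "x + h *\<^sub>R v \<in> K" using cone_subset[OF \<sigma>] elim by blast
          ultimately have "u (x + h *\<^sub>R v) = 1 - m \<sigma> \<bullet> (x + h *\<^sub>R v - a)"
            using radial_gauge_cone[OF \<sigma> elim] radial_gauge_less_1_iff[of "x + h *\<^sub>R v"] by (simp add: u_def)
          then have "u (x + h *\<^sub>R v) = 1 - m \<sigma> \<bullet> (x - a) - h * (m \<sigma> \<bullet> v)" by (simp add: inner_simps)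
          moreover have "w \<bullet> (x + h *\<^sub>R v - a) = w \<bullet> (x - a) + h * (w \<bullet> v)" by (simp add: inner_simps)
          ultimately show ?case by (simp only: f_def)
        qed
        have "((\<lambda>h. (1 - m \<sigma> \<bullet> (x - a) - h * (m \<sigma> \<bullet> v)) * (w \<bullet> (x - a) + h * (w \<bullet> v))) has_real_derivative r x \<sigma>) (at 0)"
          by (auto intro!: derivative_eq_intros simp: r_def inner_commute)
        then have "((\<lambda>h. f (x + h *\<^sub>R v)) has_real_derivative r x \<sigma>) (at 0)"
          using DERIV_cong_ev[OF refl ev refl] by simp
        then show ?thesis using sum_indicator_cone[OF \<sigma> x] by (simp add: q_def)
      next
        assume x: "x \<notin> closure K"
        have "\<forall>\<^sub>F h in nhds 0. x + h *\<^sub>R v \<in> - closure K"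
          using lim x by (intro topological_tendstoD) (auto simp: open_Compl)
        then have ev: "\<forall>\<^sub>F h in nhds 0. f (x + h *\<^sub>R v) = 0"
          by eventually_elim (use closure_subset[of K] u_out in \<open>auto simp: f_def\<close>)
        have "q x = 0"
          unfolding q_def using x cone_subset closure_subset[of K] by (intro sum.neutral) (auto simp: indicator_def)
        then show ?thesis using DERIV_cong_ev[OF refl ev refl] by simp
      qed
    qed
  qed
  also have "(LINT x|lborel. q x) = (\<Sum>\<sigma>\<in>F. LINT x:open_cone a \<sigma>|lborel. r x \<sigma>)"
    unfolding q_def set_lebesgue_integral_def real_scaleR_def
    by (rule Bochner_Integration.integral_sum)
       (use r_int(1) in \<open>simp add: set_integrable_def\<close>)
  also have "\<dots> = (\<Sum>\<sigma>\<in>F. (v \<bullet> w) * (measure lborel (open_cone a \<sigma>) - (LINT x:open_cone a \<sigma>|lborel. m \<sigma> \<bullet> (x - a))) -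
    (m \<sigma> \<bullet> v) * (LINT x:open_cone a \<sigma>|lborel. w \<bullet> (x - a)))"
    by (intro sum.cong refl) (rule r_int(2))
  finally show ?thesis .
qed

end

subsection \<open>Normals and distances of faces\<close>

text \<open>A nonempty relatively open subset affinely spans its hyperplane. Since a is off that
  hyperplane, the offset \<open>k\<close> is nonzero, and its sign orients the normalised equation
  so that N points from a towards the face.\<close>

lemma rel_open_in_hyperplane_normal_form:
  fixes \<sigma> :: "'a::euclidean_space set"
  assumes "rel_open_in_hyperplane \<sigma>" "\<sigma> \<noteq> {}" "infdist a (affine hull \<sigma>) > 0"
  obtains N \<delta> where "norm N = 1" "\<delta> > 0" "affine hull \<sigma> = {y. N \<bullet> (y - a) = \<delta>}"
    "openin (top_of_set (affine hull \<sigma>)) \<sigma>"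
proof -
  obtain b c where b: "b \<noteq> 0" and op: "openin (top_of_set {y. b \<bullet> y = c}) \<sigma>"
    using assms(1) unfolding rel_open_in_hyperplane_def by blast
  have "affine hull {y. b \<bullet> y = c} = {y. b \<bullet> y = c}" by (rule hull_same) (rule affine_hyperplane)
  note hull = affine_hull_openin[of "{y. b \<bullet> y = c}" \<sigma>, unfolded this, OF op assms(2)]
  define k where "k = c - b \<bullet> a"
  have "a \<notin> affine hull \<sigma>" using assms(3) by (metis infdist_zero less_irrefl)
  then have k: "k \<noteq> 0" by (simp add: hull k_def)
  show thesis
  proof
    show "norm ((sgn k / norm b) *\<^sub>R b) = 1" using b k by (simp add: abs_sgn_eq)
    show "\<bar>k\<bar> / norm b > 0" using b k by simp
    show "openin (top_of_set (affine hull \<sigma>)) \<sigma>" using op by (simp add: hull)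
    have "(sgn k / norm b) *\<^sub>R b \<bullet> (y - a) = \<bar>k\<bar> / norm b \<longleftrightarrow> b \<bullet> y = c" for y
    proof -
      have "(sgn k / norm b) *\<^sub>R b \<bullet> (y - a) = sgn k * (b \<bullet> y - b \<bullet> a) / norm b"
        by (simp add: inner_diff_right diff_divide_distrib right_diff_distrib)
      moreover have "\<bar>k\<bar> / norm b = sgn k * k / norm b" by (simp add: abs_sgn)
      ultimately have "(sgn k / norm b) *\<^sub>R b \<bullet> (y - a) = \<bar>k\<bar> / norm b \<longleftrightarrow> b \<bullet> y - b \<bullet> a = k"
        using b k by (simp add: sgn_eq_0_iff)
      then show ?thesis by (auto simp: k_def)
    qed
    then show "affine hull \<sigma> = {y. (sgn k / norm b) *\<^sub>R b \<bullet> (y - a) = \<bar>k\<bar> / norm b}"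
      by (simp add: hull)
  qed
qed

lemma infdist_hyperplane:
  fixes N a :: "'a::euclidean_space"
  assumes N: "norm N = 1" and \<delta>: "\<delta> \<ge> 0"
  shows "infdist a {y. N \<bullet> (y - a) = \<delta>} = \<delta>"
proof (rule antisym)
  have "a + \<delta> *\<^sub>R N \<in> {y. N \<bullet> (y - a) = \<delta>}" using N by (simp add: dot_square_norm)
  from infdist_le[OF this, of a] show "infdist a {y. N \<bullet> (y - a) = \<delta>} \<le> \<delta>"
    using N \<delta> by (simp add: dist_norm)
  show "\<delta> \<le> infdist a {y. N \<bullet> (y - a) = \<delta>}"
  proof (subst infdist_notempty)
    show "{y. N \<bullet> (y - a) = \<delta>} \<noteq> {}" using \<open>a + \<delta> *\<^sub>R N \<in> _\<close> by blast
    show "\<delta> \<le> (INF y\<in>{y. N \<bullet> (y - a) = \<delta>}. dist a y)"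
    proof (rule cINF_greatest)
      fix y assume "y \<in> {y. N \<bullet> (y - a) = \<delta>}"
      then show "\<delta> \<le> dist a y"
        using norm_cauchy_schwarz[of N "y - a"] N by (simp add: dist_norm norm_minus_commute)
    qed fact
  qed
qed

text \<open>Slightly inside the plane, points project radially into \<sigma> and so lie in the cone,
  hence in K. Slightly outside, the segment back to a crosses \<sigma>, which is disjoint from K, so
  star-shapedness excludes them. These two facts single out N from the two unit normals.\<close>

lemma outward_unit_normal_eq:
  fixes \<sigma> :: "'a::euclidean_space set"
  assumes K: "open K" and star: "\<And>y. y \<in> K \<Longrightarrow> closed_segment a y \<subseteq> K"
    and \<sigma>: "\<sigma> \<noteq> {}" "\<sigma> \<subseteq> frontier K" "open_cone a \<sigma> \<subseteq> K"
    and N: "norm N = 1" and \<delta>: "\<delta> > 0" and hull: "affine hull \<sigma> = {y. N \<bullet> (y - a) = \<delta>}"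
    and op: "openin (top_of_set (affine hull \<sigma>)) \<sigma>"
  shows "outward_unit_normal K \<sigma> = N"
proof -
  obtain U where U: "open U" and \<sigma>U: "\<sigma> = {y. N \<bullet> (y - a) = \<delta>} \<inter> U"
    using op unfolding openin_open hull by blast
  have NN: "N \<bullet> N = 1" using N by (simp add: dot_square_norm)
  have \<sigma>K: "\<sigma> \<inter> K = {}" using \<sigma>(2) K by (auto simp: frontier_def interior_open)
  \<comment> \<open>The filter is left general so that the same statement serves t tending to 0 from
    the right and, after negation, the points beyond the face.\<close>
  have radial: "\<forall>\<^sub>F t in F. a + (\<delta> / (\<delta> - t)) *\<^sub>R (y - t *\<^sub>R N - a) \<in> \<sigma>"
    if y: "y \<in> \<sigma>" and F: "filterlim (\<lambda>t. t) (nhds 0) F" for y F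
  proof -
    have "((\<lambda>t. a + (\<delta> / (\<delta> - t)) *\<^sub>R (y - t *\<^sub>R N - a)) \<longlongrightarrow> a + (\<delta> / (\<delta> - 0)) *\<^sub>R (y - 0 *\<^sub>R N - a)) F"
      using \<delta> by (intro tendsto_intros F) auto
    then have "\<forall>\<^sub>F t in F. a + (\<delta> / (\<delta> - t)) *\<^sub>R (y - t *\<^sub>R N - a) \<in> U"
      using U y \<delta> \<sigma>U by (intro topological_tendstoD) auto
    moreover have "\<forall>\<^sub>F t in F. t < \<delta>" using order_tendstoD(2)[OF F \<delta>] .
    ultimately show ?thesis
    proof eventually_elim
      case (elim t)
      have "N \<bullet> (y - t *\<^sub>R N - a) = \<delta> - t" using y \<sigma>U by (simp add: inner_simps NN)
      then show ?case using elim by (simp add: \<sigma>U)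
    qed
  qed
  have sides: "\<forall>\<^sub>F t in at_right 0. y - t *\<^sub>R N \<in> K \<and> y + t *\<^sub>R N \<notin> K" if y: "y \<in> \<sigma>" for y
  proof -
    have "\<forall>\<^sub>F t in at_right 0. a + (\<delta> / (\<delta> - t)) *\<^sub>R (y - t *\<^sub>R N - a) \<in> \<sigma>"
      by (rule radial[OF y]) (simp add: filterlim_def at_within_def le_infI1)
    moreover have "\<forall>\<^sub>F t in at_right 0. a + (\<delta> / (\<delta> + t)) *\<^sub>R (y + t *\<^sub>R N - a) \<in> \<sigma>"
    proof -
      have "((\<lambda>t::real. - t) \<longlongrightarrow> - 0) (at_right 0)" by (intro tendsto_intros)
      then have "filterlim (\<lambda>t. t) (nhds 0) (filtermap (\<lambda>t::real. - t) (at_right 0))"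
        by (simp add: filterlim_filtermap)
      from radial[OF y this] show ?thesis by (simp add: eventually_filtermap)
    qed
    moreover have "\<forall>\<^sub>F t in at_right 0. t \<in> {0<..<\<delta>}" using \<delta> by (rule eventually_at_right_real)
    ultimately show ?thesis
    proof eventually_elim
      case (elim t)
      have t: "0 < t" "t < \<delta>" using elim by auto
      have "N \<bullet> (y - t *\<^sub>R N - a) = \<delta> - t" using y \<sigma>U by (simp add: inner_simps NN)
      then have "y - t *\<^sub>R N \<in> open_cone a \<sigma>"
        using mem_open_cone_iff[of \<sigma> N a \<delta> "y - t *\<^sub>R N"] \<sigma>U \<delta> t elim(1) by simp
      moreover have "y + t *\<^sub>R N \<notin> K"
      proof
        assume "y + t *\<^sub>R N \<in> K"
        moreover have "a + (\<delta> / (\<delta> + t)) *\<^sub>R (y + t *\<^sub>R N - a) \<in> closed_segment a (y + t *\<^sub>R N)"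
          unfolding closed_segment_def using t \<delta>
          by (intro CollectI exI[of _ "\<delta> / (\<delta> + t)"]) (simp add: algebra_simps)
        ultimately show False using star elim(2) \<sigma>K by blast
      qed
      ultimately show ?case using \<sigma>(3) by blast
    qed
  qed
  obtain y0 where y0: "y0 \<in> \<sigma>" using \<sigma>(1) by blast
  show ?thesis
    unfolding outward_unit_normal_def
  proof (rule the_equality)
    show "norm N = 1 \<and> (\<forall>y\<in>\<sigma>. \<forall>z\<in>\<sigma>. N \<bullet> (y - z) = 0) \<and>
        (\<forall>y\<in>\<sigma>. \<forall>\<^sub>F t in at_right 0. y - t *\<^sub>R N \<in> K \<and> y + t *\<^sub>R N \<notin> K)"
      using N sides by (auto simp: \<sigma>U inner_diff_right)
  next
    fix n assume n: "norm n = 1 \<and> (\<forall>y\<in>\<sigma>. \<forall>z\<in>\<sigma>. n \<bullet> (y - z) = 0) \<and>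
        (\<forall>y\<in>\<sigma>. \<forall>\<^sub>F t in at_right 0. y - t *\<^sub>R n \<in> K \<and> y + t *\<^sub>R n \<notin> K)"
    have "\<sigma> \<subseteq> {z. n \<bullet> z = n \<bullet> y0}"
    proof
      fix z assume "z \<in> \<sigma>"
      then have "n \<bullet> (z - y0) = 0" using n y0 by blast
      then show "z \<in> {z. n \<bullet> z = n \<bullet> y0}" by (simp add: inner_diff_right)
    qed
    then have hull_sub: "affine hull \<sigma> \<subseteq> {z. n \<bullet> z = n \<bullet> y0}" by (rule hull_minimal) (rule affine_hyperplane)
    \<comment> \<open>The part of \<open>n\<close> tangential to the face plane. As
      \<open>y0 + v\<close> lies in the affine hull, on which \<open>n\<close> is constant, this
      part is orthogonal to \<open>n\<close> and therefore zero.\<close>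
    define v where "v = n - (n \<bullet> N) *\<^sub>R N"
    have Nv: "N \<bullet> v = 0" by (simp add: v_def inner_diff_right NN inner_commute)
    have "N \<bullet> (y0 - a) = \<delta>" using y0 \<sigma>U by blast
    then have "y0 + v \<in> affine hull \<sigma>" using Nv unfolding hull by (simp add: inner_simps)
    then have "n \<bullet> v = 0" using hull_sub by (auto simp: inner_add_right)
    then have "v \<bullet> v = 0" using Nv by (simp add: v_def inner_diff_left)
    then have nN: "n = (n \<bullet> N) *\<^sub>R N" by (simp add: v_def)
    then have "norm n = \<bar>n \<bullet> N\<bar> * norm N" by (metis norm_scaleR)
    then have "n \<bullet> N = 1 \<or> n \<bullet> N = - 1" using conjunct1[OF n] N by (auto simp: abs_if split: if_splits)
    then have "n = N \<or> n = - N" using nN by auto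
    moreover have "n \<noteq> - N"
    proof
      assume "n = - N"
      have "\<forall>\<^sub>F t in at_right 0. y0 - t *\<^sub>R n \<in> K \<and> y0 + t *\<^sub>R n \<notin> K" using n y0 by blast
      then have "\<forall>\<^sub>F t in at_right 0. y0 + t *\<^sub>R N \<in> K" by eventually_elim (simp add: \<open>n = - N\<close>)
      with sides[OF y0] have "\<forall>\<^sub>F t in at_right (0::real). False" by eventually_elim simp
      then show False by simp
    qed
    ultimately show "n = N" by blast
  qed
qed

text \<open>The height is homogeneous of degree one and constantly \<delta> on the base, so no
  centroid appears.\<close>

lemma integral_open_cone_height:
  fixes \<sigma> :: "'a::euclidean_space set"
  assumes N: "norm N = 1" and \<delta>: "\<delta> > 0" and hull: "affine hull \<sigma> = {y. N \<bullet> (y - a) = \<delta>}"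
    and \<sigma>: "\<sigma> \<in> sets borel"
  shows "(LINT x:open_cone a \<sigma>|lborel. N \<bullet> (x - a)) = \<delta> / real (Suc DIM('a)) * face_measure \<sigma> * \<delta>"
proof -
  let ?\<mu> = "affine_lborel (affine hull \<sigma>)"
  have [measurable_cong]: "sets ?\<mu> = sets borel" by (rule sets_affine_lborel_face[OF N \<delta> hull \<sigma>])
  have "N \<bullet> (a + t *\<^sub>R (y - a) - a) = t ^ 1 * (N \<bullet> (y - a))" for t y by simp
  note integral_open_cone[OF N \<delta> hull \<sigma> _ this]
  then have "(LINT x:open_cone a \<sigma>|lborel. N \<bullet> (x - a)) = \<delta> / real (1 + DIM('a)) * (LINT y:\<sigma>|?\<mu>. N \<bullet> (y - a))"
    by simp
  also have "(LINT y:\<sigma>|?\<mu>. N \<bullet> (y - a)) = (LINT y:\<sigma>|?\<mu>. \<delta>)"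
  proof (rule set_lebesgue_integral_cong)
    show "\<sigma> \<in> sets ?\<mu>" using \<sigma> by (simp only: sets_affine_lborel_face[OF N \<delta> hull \<sigma>])
    show "\<forall>y. y \<in> \<sigma> \<longrightarrow> N \<bullet> (y - a) = \<delta>" using hull hull_subset[of \<sigma> affine] by auto
  qed
  also have "\<dots> = face_measure \<sigma> * \<delta>"
  proof -
    have "\<sigma> \<inter> space ?\<mu> = \<sigma>" using sets_eq_imp_space_eq[OF sets_affine_lborel_face[OF N \<delta> hull \<sigma>]] by simp
    then show ?thesis by (simp add: set_lebesgue_integral_def face_measure_def)
  qed
  finally show ?thesis by simp
qed

section \<open>The divergence identity in terms of normals, distances and centroids\<close>

locale star_polytope =
  fixes K :: "'a::euclidean_space set" and a :: 'a and F :: "'a set set" and N :: "'a set \<Rightarrow> 'a" and \<delta> :: "'a set \<Rightarrow> real"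
  assumes open_K: "open K" and bounded_K: "bounded K" and a_in: "a \<in> K"
    and star: "\<And>y. y \<in> K \<Longrightarrow> closed_segment a y \<subseteq> K"
    and finite_F: "finite F" and face_sub: "\<And>\<sigma>. \<sigma> \<in> F \<Longrightarrow> \<sigma> \<subseteq> frontier K"
    and face_nonempty: "\<And>\<sigma>. \<sigma> \<in> F \<Longrightarrow> \<sigma> \<noteq> {}"
    and borel_face: "\<And>\<sigma>. \<sigma> \<in> F \<Longrightarrow> \<sigma> \<in> sets borel"
    and N: "\<And>\<sigma>. \<sigma> \<in> F \<Longrightarrow> norm (N \<sigma>) = 1"
    and \<delta>: "\<And>\<sigma>. \<sigma> \<in> F \<Longrightarrow> \<delta> \<sigma> > 0"
    and hull: "\<And>\<sigma>. \<sigma> \<in> F \<Longrightarrow> affine hull \<sigma> = {y. N \<sigma> \<bullet> (y - a) = \<delta> \<sigma>}"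
    and cover: "frontier K \<subseteq> (\<Union>\<sigma>\<in>F. closure \<sigma>)"
    and open_cones: "\<And>\<sigma>. \<sigma> \<in> F \<Longrightarrow> open (open_cone a \<sigma>)"
    and cones: "null_partition F (open_cone a) K"
begin

sublocale star_cell K a F "\<lambda>\<sigma>. (1 / \<delta> \<sigma>) *\<^sub>R N \<sigma>"
proof
  fix \<sigma> y assume \<sigma>: "\<sigma> \<in> F" and y: "y \<in> \<sigma>"
  then have "y \<in> affine hull \<sigma>" by (simp add: hull_inc)
  then have "N \<sigma> \<bullet> (y - a) = \<delta> \<sigma>" by (simp add: hull[OF \<sigma>])
  then show "(1 / \<delta> \<sigma>) *\<^sub>R N \<sigma> \<bullet> (y - a) = 1" using \<delta>[OF \<sigma>] by simp
qed (use open_K bounded_K a_in star finite_F face_sub cover open_cones cones in auto)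

text \<open>The cone is open and nonempty, so its volume is positive; the cone formula transfers
  this to the face.\<close>

lemma face_measure_pos:
  assumes \<sigma>: "\<sigma> \<in> F"
  shows "face_measure \<sigma> > 0"
proof -
  let ?C = "open_cone a \<sigma>"
  obtain y where "y \<in> \<sigma>" using face_nonempty[OF \<sigma>] by blast
  then have "(1 - 1/2) *\<^sub>R a + (1/2) *\<^sub>R y \<in> ?C"
    unfolding open_cone_def by (intro CollectI exI[of _ "1/2"] exI[of _ y]) simp
  then have "?C \<noteq> {}" by blast
  moreover have "bounded ?C" using bounded_subset[OF bounded_K cone_subset[OF \<sigma>]] .
  ultimately have "measure lebesgue ?C \<noteq> 0"
    using open_not_negligible[OF open_cones[OF \<sigma>]] lmeasurable_open[OF _ open_cones[OF \<sigma>]] negligible_iff_measure0 by blast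
  then have "measure lborel ?C \<noteq> 0" using open_cones[OF \<sigma>] by simp
  then have "\<delta> \<sigma> / real DIM('a) * face_measure \<sigma> \<noteq> 0"
    using measure_open_cone[OF N[OF \<sigma>] \<delta>[OF \<sigma>] hull[OF \<sigma>] borel_face[OF \<sigma>]] by simp
  moreover have "face_measure \<sigma> \<ge> 0" by (simp add: face_measure_def)
  ultimately show ?thesis by (metis less_eq_real_def mult_zero_right)
qed

lemma bounded_face: "\<sigma> \<in> F \<Longrightarrow> bounded \<sigma>"
  by (rule bounded_subset[OF bounded_closure[OF bounded_K]]) (use face_sub in \<open>unfold frontier_def, blast\<close>)

lemma sum_measure_cones: "(\<Sum>\<sigma>\<in>F. measure lborel (open_cone a \<sigma>)) = measure lebesgue K"
proof -
  let ?C = "\<Union>\<sigma>\<in>F. open_cone a \<sigma>"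
  have C: "open_cone a \<sigma> \<in> lmeasurable" if "\<sigma> \<in> F" for \<sigma>
    using bounded_subset[OF bounded_K cone_subset[OF that]] open_cones[OF that] by (rule lmeasurable_open)
  have "measure lebesgue ?C = (\<Sum>\<sigma>\<in>F. measure lebesgue (open_cone a \<sigma>))"
  proof (rule measure_finite_Union[OF finite_F])
    show "open_cone a ` F \<subseteq> sets lebesgue" using C by (blast dest: fmeasurableD)
    show "disjoint_family_on (open_cone a) F" using cones by (simp add: null_partition_def)
    show "emeasure lebesgue (open_cone a \<sigma>) \<noteq> \<infinity>" if "\<sigma> \<in> F" for \<sigma>
      using C[OF that] unfolding fmeasurable_def mem_Collect_eq by (rule less_imp_neq[OF conjunct2])
  qed
  also have "\<dots> = (\<Sum>\<sigma>\<in>F. measure lborel (open_cone a \<sigma>))"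
    using open_cones by (intro sum.cong refl) simp
  finally have "(\<Sum>\<sigma>\<in>F. measure lborel (open_cone a \<sigma>)) = measure lebesgue ?C" ..
  also have "\<dots> = measure lebesgue K"
  proof (rule measure_negligible_symdiff)
    show "K \<in> lmeasurable" using bounded_K open_K by (rule lmeasurable_open)
    have "K - ?C \<union> (?C - K) = K - ?C" using cone_subset by blast
    then show "negligible (K - ?C \<union> (?C - K))" using cones by (simp add: null_partition_def)
  qed
  finally show ?thesis .
qed

text \<open>The divergence theorem on \<open>K\<close> for the vector field \<open>x \<mapsto> (w \<bullet> (x - a)) *\<^sub>R v\<close>.\<close>

lemma sum_normal_inner_centroid:
  "(\<Sum>\<sigma>\<in>F. face_measure \<sigma> * (N \<sigma> \<bullet> v) * (w \<bullet> (face_centroid \<sigma> - a))) = measure lebesgue K * (v \<bullet> w)"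
proof -
  let ?D = "real DIM('a)"
  have D: "?D > 0" by simp
  have S: "real (Suc DIM('a)) = ?D + 1" by simp
  have "0 = (\<Sum>\<sigma>\<in>F. (v \<bullet> w) * (measure lborel (open_cone a \<sigma>) - (LINT x:open_cone a \<sigma>|lborel. (1 / \<delta> \<sigma>) *\<^sub>R N \<sigma> \<bullet> (x - a))) -
      ((1 / \<delta> \<sigma>) *\<^sub>R N \<sigma> \<bullet> v) * (LINT x:open_cone a \<sigma>|lborel. w \<bullet> (x - a)))"
    by (rule sum_cone_integrals_eq_0[symmetric])
       (rule set_integrable_open_cone_inner[OF N \<delta> hull borel_face bounded_face face_measure_pos])
  also have "\<dots> = (\<Sum>\<sigma>\<in>F. ((v \<bullet> w) * measure lborel (open_cone a \<sigma>) -
      face_measure \<sigma> * (N \<sigma> \<bullet> v) * (w \<bullet> (face_centroid \<sigma> - a))) / (?D + 1))"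
  proof (intro sum.cong refl)
    fix \<sigma> assume \<sigma>: "\<sigma> \<in> F"
    let ?C = "open_cone a \<sigma>"
    note h = N[OF \<sigma>] \<delta>[OF \<sigma>] hull[OF \<sigma>] borel_face[OF \<sigma>]
    have "(LINT x:?C|lborel. (1 / \<delta> \<sigma>) *\<^sub>R N \<sigma> \<bullet> (x - a)) = (1 / \<delta> \<sigma>) * (LINT x:?C|lborel. N \<sigma> \<bullet> (x - a))"
      by simp
    also have "\<dots> = \<delta> \<sigma> * face_measure \<sigma> / (?D + 1)"
      using h(2) by (simp only: integral_open_cone_height[OF h] S) simp
    finally have 1: "(LINT x:?C|lborel. (1 / \<delta> \<sigma>) *\<^sub>R N \<sigma> \<bullet> (x - a)) = \<delta> \<sigma> * face_measure \<sigma> / (?D + 1)" .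
    have 2: "measure lborel ?C = \<delta> \<sigma> * face_measure \<sigma> / ?D"
      by (simp add: measure_open_cone[OF h])
    \<comment> \<open>From 1 / D - 1 / (D + 1) = 1 / (D (D + 1)): the volume term acquires the same
      factor 1 / (D + 1) as the centroid term.\<close>
    have 3: "measure lborel ?C - (LINT x:?C|lborel. (1 / \<delta> \<sigma>) *\<^sub>R N \<sigma> \<bullet> (x - a)) = measure lborel ?C / (?D + 1)"
      unfolding 1 2 using D by (simp add: field_simps)
    have 4: "(1 / \<delta> \<sigma>) *\<^sub>R N \<sigma> \<bullet> v * (LINT x:?C|lborel. w \<bullet> (x - a)) =
        face_measure \<sigma> * (N \<sigma> \<bullet> v) * (w \<bullet> (face_centroid \<sigma> - a)) / (?D + 1)"
      unfolding integral_open_cone_inner[OF h bounded_face[OF \<sigma>] face_measure_pos[OF \<sigma>]] S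
      using h(2) by simp
    show "(v \<bullet> w) * (measure lborel ?C - (LINT x:?C|lborel. (1 / \<delta> \<sigma>) *\<^sub>R N \<sigma> \<bullet> (x - a))) -
        ((1 / \<delta> \<sigma>) *\<^sub>R N \<sigma> \<bullet> v) * (LINT x:?C|lborel. w \<bullet> (x - a)) =
        ((v \<bullet> w) * measure lborel ?C - face_measure \<sigma> * (N \<sigma> \<bullet> v) * (w \<bullet> (face_centroid \<sigma> - a))) / (?D + 1)"
      unfolding 3 4 by (simp add: diff_divide_distrib)
  qed
  also have "\<dots> = ((v \<bullet> w) * (\<Sum>\<sigma>\<in>F. measure lborel (open_cone a \<sigma>)) -
      (\<Sum>\<sigma>\<in>F. face_measure \<sigma> * (N \<sigma> \<bullet> v) * (w \<bullet> (face_centroid \<sigma> - a)))) / (?D + 1)"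
    by (simp only: sum_divide_distrib[symmetric] sum_subtractf sum_distrib_left)
  finally have "(v \<bullet> w) * (\<Sum>\<sigma>\<in>F. measure lborel (open_cone a \<sigma>)) -
      (\<Sum>\<sigma>\<in>F. face_measure \<sigma> * (N \<sigma> \<bullet> v) * (w \<bullet> (face_centroid \<sigma> - a))) = 0"
    using D by (simp add: divide_eq_0_iff)
  then show ?thesis by (simp add: sum_measure_cones mult.commute)
qed

end

subsection \<open>Bilinear forms on the mesh\<close>

text \<open>The data of the normal form are identified with the mesh quantities: N with the normal
  defined by a unique description, \<delta> with the distance to the affine hull.\<close>

lemma mesh_cell_star_polytope:
  assumes mesh: "polytopal_mesh \<Omega> M" and K: "K \<in> cells M"
  shows "star_polytope K (point M K) (faces M K) (outward_unit_normal K) (face_dist M K)"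
proof -
  let ?a = "point M K"
  have cell: "open K" "bounded K" "?a \<in> K" "\<And>y. y \<in> K \<Longrightarrow> closed_segment ?a y \<subseteq> K" "finite (faces M K)"
    "frontier K \<subseteq> (\<Union>\<sigma>\<in>faces M K. closure \<sigma>)" "null_partition (faces M K) (open_cone ?a) K"
    using mesh K unfolding polytopal_mesh_def polytopal_open_def face_cone_def[abs_def] by blast+
  have face: "\<sigma> \<noteq> {}" "rel_open_in_hyperplane \<sigma>" "\<sigma> \<subseteq> frontier K" "infdist ?a (affine hull \<sigma>) > 0"
      if "\<sigma> \<in> faces M K" for \<sigma>
    using mesh K that unfolding polytopal_mesh_def face_dist_def by blast+
  have "norm (outward_unit_normal K \<sigma>) = 1 \<and> face_dist M K \<sigma> > 0 \<and>
      affine hull \<sigma> = {y. outward_unit_normal K \<sigma> \<bullet> (y - ?a) = face_dist M K \<sigma>} \<and> \<sigma> \<in> sets borel"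
    if \<sigma>: "\<sigma> \<in> faces M K" for \<sigma>
  proof -
    obtain N \<delta> where N: "norm N = 1" and \<delta>: "\<delta> > 0" and hull: "affine hull \<sigma> = {y. N \<bullet> (y - ?a) = \<delta>}"
      and op: "openin (top_of_set (affine hull \<sigma>)) \<sigma>"
      using rel_open_in_hyperplane_normal_form[OF face(2,1,4)[OF \<sigma>]] by blast
    have "open_cone ?a \<sigma> \<subseteq> K" using cell(7) \<sigma> by (auto simp: null_partition_def)
    then have "outward_unit_normal K \<sigma> = N"
      using cell(4) by (intro outward_unit_normal_eq[OF cell(1) _ face(1,3)[OF \<sigma>] _ N \<delta> hull op])
    moreover have "face_dist M K \<sigma> = \<delta>"
      using infdist_hyperplane[OF N, of \<delta> ?a] \<delta> by (simp add: face_dist_def hull)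
    moreover have "\<sigma> \<in> sets borel"
    proof -
      obtain U where "open U" "\<sigma> = affine hull \<sigma> \<inter> U" using op unfolding openin_open by blast
      then show ?thesis using closed_affine_hull[of \<sigma>] by (metis borel_closed borel_open sets.Int)
    qed
    ultimately show ?thesis using N \<delta> hull by simp
  qed
  moreover have "open (open_cone ?a \<sigma>)" if "\<sigma> \<in> faces M K" for \<sigma>
    by (rule open_open_cone[OF face(2,4)[OF that]])
  ultimately show ?thesis using cell face(1,3) by unfold_locales auto
qed

lemma borel_measurable_matrix_form:
  fixes f :: "'a \<Rightarrow> real^'n^'m"
  assumes f: "f \<in> borel_measurable M" and g: "g \<in> borel_measurable M" and h: "h \<in> borel_measurable M"
  shows "(\<lambda>x. (f x *v g x) \<bullet> h x) \<in> borel_measurable M"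
proof -
  have [measurable]: "(\<lambda>x. f x $ i $ j) \<in> borel_measurable M" for i j
    by (rule measurable_compose[OF f borel_measurable_continuous_onI]) (intro continuous_intros)
  have [measurable]: "(\<lambda>x. g x $ i) \<in> borel_measurable M" "(\<lambda>x. h x $ j) \<in> borel_measurable M" for i j
    by (rule measurable_compose[OF g borel_measurable_nth] measurable_compose[OF h borel_measurable_nth])+
  show ?thesis unfolding matrix_vector_mult_def inner_vec_def by simp
qed

lemma fe_form_eq_sum_cones:
  assumes mesh: "polytopal_mesh \<Omega> M"
  shows "fe_form \<Omega> M \<Lambda> \<beta> p q = (\<Sum>K\<in>cells M. \<Sum>\<sigma>\<in>faces M K. measure lborel (face_cone M K \<sigma>) *
    ((cell_mean \<Lambda> K *v cone_grad M \<beta> K \<sigma> p) \<bullet> cone_grad M \<beta> K \<sigma> q))"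
proof -
  let ?G = "\<lambda>x. (mean_tensor M \<Lambda> x *v broken_grad M \<beta> p x) \<bullet> broken_grad M \<beta> q x"
  define c where "c K \<sigma> = (cell_mean \<Lambda> K *v cone_grad M \<beta> K \<sigma> p) \<bullet> cone_grad M \<beta> K \<sigma> q" for K \<sigma>
  define g where "g x = (\<Sum>K\<in>cells M. \<Sum>\<sigma>\<in>faces M K. indicator (face_cone M K \<sigma>) x *\<^sub>R c K \<sigma>)" for x
  have \<Omega>: "open \<Omega>" and part: "null_partition (cells M) (\<lambda>K. K) \<Omega>"
    using mesh by (auto simp: polytopal_mesh_def polytopal_open_def)
  have fin: "finite (cells M)" and sub: "\<And>K. K \<in> cells M \<Longrightarrow> K \<subseteq> \<Omega>"
    and disj: "\<And>K L x. K \<in> cells M \<Longrightarrow> L \<in> cells M \<Longrightarrow> x \<in> K \<Longrightarrow> x \<in> L \<Longrightarrow> K = L"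
    using part by (auto simp: null_partition_def disjoint_family_on_def)
  have poly: "star_polytope K (point M K) (faces M K) (outward_unit_normal K) (face_dist M K)"
    if "K \<in> cells M" for K by (rule mesh_cell_star_polytope[OF mesh that])
  have open_cell: "open K" if "K \<in> cells M" for K using star_polytope.open_K[OF poly[OF that]] .
  have bounded_cell: "bounded K" if "K \<in> cells M" for K using star_polytope.bounded_K[OF poly[OF that]] .
  have cone_part: "null_partition (faces M K) (face_cone M K) K" if "K \<in> cells M" for K
    using mesh that by (auto simp: polytopal_mesh_def)
  have cone_sub: "face_cone M K \<sigma> \<subseteq> K" if "K \<in> cells M" "\<sigma> \<in> faces M K" for K \<sigma>
    using cone_part[OF that(1)] that(2) by (auto simp: null_partition_def)
  have open_cone: "open (face_cone M K \<sigma>)" if "K \<in> cells M" "\<sigma> \<in> faces M K" for K \<sigma>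
    using star_polytope.open_cones[OF poly[OF that(1)] that(2)] by (simp add: face_cone_def)
  have AE: "AE x in lebesgue. indicator \<Omega> x *\<^sub>R ?G x = g x"
  proof -
    \<comment> \<open>The integrand can differ from its conewise constant version only outside the
      cells or, within a cell, outside the cones.\<close>
    have "negligible ((\<Omega> - \<Union>(cells M)) \<union> (\<Union>K\<in>cells M. K - (\<Union>\<sigma>\<in>faces M K. face_cone M K \<sigma>)))"
      using part cone_part fin by (intro negligible_Un negligible_Union) (auto simp: null_partition_def)
    then have "AE x in lebesgue. x \<notin> (\<Omega> - \<Union>(cells M)) \<union> (\<Union>K\<in>cells M. K - (\<Union>\<sigma>\<in>faces M K. face_cone M K \<sigma>))"
      unfolding negligible_iff_null_sets by (rule AE_not_in)
    then show ?thesis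
    proof eventually_elim
      case (elim x)
      show ?case
      proof (cases "x \<in> \<Omega>")
        case True
        then obtain K \<sigma> where K: "K \<in> cells M" and \<sigma>: "\<sigma> \<in> faces M K" and x: "x \<in> face_cone M K \<sigma>"
          using elim by blast
        note sum = face_cone_sum[OF mesh K \<sigma> x]
        have "x \<in> K" using cone_sub[OF K \<sigma>] x by blast
        have "mean_tensor M \<Lambda> x = (\<Sum>L\<in>cells M. if L = K then cell_mean \<Lambda> K else 0)"
          unfolding mean_tensor_def
        proof (intro sum.cong refl)
          fix L assume "L \<in> cells M"
          then have "x \<in> L \<longleftrightarrow> L = K" using disj[OF _ K _ \<open>x \<in> K\<close>] \<open>x \<in> K\<close> by blast
          then show "indicator L x *\<^sub>R cell_mean \<Lambda> L = (if L = K then cell_mean \<Lambda> K else 0)" by (simp add: indicator_def)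
        qed
        also have "\<dots> = cell_mean \<Lambda> K" using fin K by simp
        finally show ?thesis
          using True by (simp only: broken_grad_def g_def sum) (simp add: c_def)
      next
        case False
        then have "g x = 0"
          unfolding g_def
        proof (intro sum.neutral ballI)
          fix K \<sigma> assume "K \<in> cells M" "\<sigma> \<in> faces M K"
          then have "x \<notin> face_cone M K \<sigma>" using False sub cone_sub by blast
          then show "indicator (face_cone M K \<sigma>) x *\<^sub>R c K \<sigma> = 0" by simp
        qed
        then show ?thesis using False by simp
      qed
    qed
  qed
  have meas_cone: "face_cone M K \<sigma> \<in> sets lebesgue" if "K \<in> cells M" "\<sigma> \<in> faces M K" for K \<sigma>
    using open_cone[OF that] by simp
  have meas_cell: "K \<in> sets lebesgue" if "K \<in> cells M" for K using open_cell[OF that] by simp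
  have bg: "broken_grad M \<beta> r \<in> borel_measurable lebesgue" for r
    unfolding broken_grad_def[abs_def] using meas_cone
    by (intro borel_measurable_sum borel_measurable_scaleR borel_measurable_indicator) auto
  have "mean_tensor M \<Lambda> \<in> borel_measurable lebesgue"
    unfolding mean_tensor_def[abs_def] using meas_cell
    by (intro borel_measurable_sum borel_measurable_scaleR borel_measurable_indicator) auto
  from borel_measurable_matrix_form[OF this bg bg]
  have meas_G: "(\<lambda>x. indicator \<Omega> x *\<^sub>R ?G x) \<in> borel_measurable lebesgue"
    using \<Omega> by (intro borel_measurable_scaleR borel_measurable_indicator) auto
  have meas_g: "g \<in> borel_measurable lebesgue"
    unfolding g_def[abs_def] using meas_cone
    by (intro borel_measurable_sum borel_measurable_scaleR borel_measurable_indicator) auto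
  have int: "integrable lebesgue (\<lambda>x. indicator (face_cone M K \<sigma>) x *\<^sub>R c K \<sigma>)"
    and lint: "(LINT x|lebesgue. indicator (face_cone M K \<sigma>) x *\<^sub>R c K \<sigma>) = measure lborel (face_cone M K \<sigma>) * c K \<sigma>"
    if "K \<in> cells M" "\<sigma> \<in> faces M K" for K \<sigma>
  proof -
    have "face_cone M K \<sigma> \<in> lmeasurable"
      using bounded_subset[OF bounded_cell[OF that(1)] cone_sub[OF that]] open_cone[OF that] by (rule lmeasurable_open)
    then have *: "integrable lebesgue (indicator (face_cone M K \<sigma>) :: _ \<Rightarrow> real)"
      by (intro integrable_real_indicator) (auto simp: fmeasurable_def simp del: emeasure_completion)
    then show "integrable lebesgue (\<lambda>x. indicator (face_cone M K \<sigma>) x *\<^sub>R c K \<sigma>)"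
      by (rule integrable_scaleR_left)
    have "(LINT x|lebesgue. indicator (face_cone M K \<sigma>) x *\<^sub>R c K \<sigma>) = measure lebesgue (face_cone M K \<sigma>) *\<^sub>R c K \<sigma>"
      using integral_scaleR_left[of "c K \<sigma>", OF *] by simp
    then show "(LINT x|lebesgue. indicator (face_cone M K \<sigma>) x *\<^sub>R c K \<sigma>) = measure lborel (face_cone M K \<sigma>) * c K \<sigma>"
      using open_cone[OF that] by simp
  qed
  have "fe_form \<Omega> M \<Lambda> \<beta> p q = (LINT x|lebesgue. g x)"
    unfolding fe_form_def set_lebesgue_integral_def by (rule integral_cong_AE[OF meas_G meas_g AE])
  also have "\<dots> = (\<Sum>K\<in>cells M. \<Sum>\<sigma>\<in>faces M K. LINT x|lebesgue. indicator (face_cone M K \<sigma>) x *\<^sub>R c K \<sigma>)"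
    unfolding g_def using int by (simp add: Bochner_Integration.integral_sum integrable_sum)
  also have "\<dots> = (\<Sum>K\<in>cells M. \<Sum>\<sigma>\<in>faces M K. measure lborel (face_cone M K \<sigma>) * c K \<sigma>)"
    using lint by (intro sum.cong refl) auto
  finally show ?thesis by (simp add: c_def)
qed

text \<open>By the divergence theorem the residuals are orthogonal to the normals, so the mixed terms of the
  cone-wise expansion cancel.\<close>

lemma sum_face_residual_normal:
  assumes mesh: "polytopal_mesh \<Omega> M" and K: "K \<in> cells M"
  shows "(\<Sum>\<sigma>\<in>faces M K. face_measure \<sigma> * face_residual M K p \<sigma> * (outward_unit_normal K \<sigma> \<bullet> v)) = 0"
proof -
  interpret star_polytope K "point M K" "faces M K" "outward_unit_normal K" "face_dist M K"
    by (rule mesh_cell_star_polytope[OF mesh K])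
  let ?n = "outward_unit_normal K" and ?G = "cell_grad M K p"
  have "measure lebesgue K \<noteq> 0"
    using open_not_negligible[OF open_K] a_in lmeasurable_open[OF bounded_K open_K] negligible_iff_measure0 by blast
  then have "measure lebesgue K * (?G \<bullet> v) =
      (\<Sum>\<sigma>\<in>faces M K. face_measure \<sigma> * (snd p \<sigma> - fst p K) * (?n \<sigma> \<bullet> v))"
    by (simp add: cell_grad_def inner_sum_left)
  \<comment> \<open>The divergence identity with w equal to the cell gradient; subtracting it from
    the definition of that gradient leaves exactly the residuals.\<close>
  moreover have "measure lebesgue K * (?G \<bullet> v) =
      (\<Sum>\<sigma>\<in>faces M K. face_measure \<sigma> * (?n \<sigma> \<bullet> v) * (?G \<bullet> (face_centroid \<sigma> - point M K)))"
    using sum_normal_inner_centroid[of v ?G] by (simp add: inner_commute)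
  ultimately show ?thesis
    by (simp add: face_residual_def algebra_simps sum_subtractf sum.distrib)
qed

section \<open>Positivity of the averaged tensor, the identity on one cell, and its assembly\<close>

lemma cell_mean_coercive:
  fixes \<Lambda> :: "real^'n \<Rightarrow> real^'n^'n"
  assumes tensor: "diffusion_tensor \<Omega> \<Lambda>" and K: "open K" "bounded K" "K \<noteq> {}" "K \<subseteq> \<Omega>" and \<Omega>: "open \<Omega>"
    and \<xi>: "\<xi> \<noteq> 0"
  shows "(cell_mean \<Lambda> K *v \<xi>) \<bullet> \<xi> > 0"
proof -
  obtain C \<zeta> where \<Lambda>: "\<Lambda> \<in> borel_measurable (lebesgue_on \<Omega>)" and C: "AE x in lebesgue_on \<Omega>. norm (\<Lambda> x) \<le> C"
    and \<zeta>: "\<zeta> > 0" and ell: "AE x in lebesgue_on \<Omega>. \<forall>\<xi>. (\<Lambda> x *v \<xi>) \<bullet> \<xi> \<ge> \<zeta> * (norm \<xi>)\<^sup>2"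
    using tensor unfolding diffusion_tensor_def by blast
  have \<Omega>s: "\<Omega> \<inter> space lebesgue \<in> sets lebesgue" using \<Omega> by simp
  have Klm: "K \<in> lmeasurable" using K by (simp add: lmeasurable_open)
  then have Kfin: "emeasure lebesgue K < \<infinity>" and Ks: "K \<in> sets lebesgue"
    unfolding fmeasurable_def mem_Collect_eq by (rule conjunct2, rule conjunct1)
  have pos: "measure lebesgue K > 0"
    using open_not_negligible[OF K(1,3)] Klm negligible_iff_measure0 measure_nonneg[of lebesgue K]
    by (metis less_eq_real_def)
  \<comment> \<open>Measurability and the bound are given on \<Omega> only, so \<Lambda> is first
    extended by zero; on K the extension changes nothing.\<close>
  have "(\<lambda>x. indicator \<Omega> x *\<^sub>R \<Lambda> x) \<in> borel_measurable lebesgue"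
    using \<Lambda> borel_measurable_restrict_space_iff[OF \<Omega>s] by blast
  moreover have "AE x in lebesgue. x \<in> K \<longrightarrow> norm (indicator \<Omega> x *\<^sub>R \<Lambda> x) \<le> C"
    using C unfolding AE_restrict_space_iff[OF \<Omega>s] by eventually_elim (use K in auto)
  ultimately have "integrable lebesgue (\<lambda>x. indicator K x *\<^sub>R (indicator \<Omega> x *\<^sub>R \<Lambda> x))"
    by (intro integrableI_bounded_set_indicator[OF Ks _ Kfin])
  moreover have "indicator K x *\<^sub>R (indicator \<Omega> x *\<^sub>R \<Lambda> x) = indicator K x *\<^sub>R \<Lambda> x" for x
    using K(4) by (auto simp: indicator_def)
  ultimately have int: "integrable lebesgue (\<lambda>x. indicator K x *\<^sub>R \<Lambda> x)" by (simp only:)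
  \<comment> \<open>For fixed \<xi> the quadratic form is a bounded linear functional of the matrix,
    so it commutes with the integral and inherits the pointwise lower bound.\<close>
  define \<phi> where "\<phi> A = (A *v \<xi>) \<bullet> \<xi>" for A :: "real^'n^'n"
  have \<phi>: "bounded_linear \<phi>"
    unfolding linear_conv_bounded_linear[symmetric]
    by (rule linearI) (simp_all add: \<phi>_def matrix_vector_mult_add_rdistrib inner_add_left scaleR_matrix_vector_assoc[symmetric])
  have "0 < \<zeta> * (norm \<xi>)\<^sup>2 * measure lebesgue K" using \<zeta> \<xi> pos by simp
  also have "\<dots> = (LINT x|lebesgue. indicator K x * (\<zeta> * (norm \<xi>)\<^sup>2))" by simp
  also have "\<dots> \<le> (LINT x|lebesgue. \<phi> (indicator K x *\<^sub>R \<Lambda> x))"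
  proof (rule integral_mono_AE)
    show "integrable lebesgue (\<lambda>x. indicator K x * (\<zeta> * (norm \<xi>)\<^sup>2))"
      using Kfin Ks by (intro integrable_mult_left integrable_real_indicator)
    show "integrable lebesgue (\<lambda>x. \<phi> (indicator K x *\<^sub>R \<Lambda> x))"
      by (rule integrable_bounded_linear[OF \<phi> int])
    show "AE x in lebesgue. indicator K x * (\<zeta> * (norm \<xi>)\<^sup>2) \<le> \<phi> (indicator K x *\<^sub>R \<Lambda> x)"
      using ell unfolding AE_restrict_space_iff[OF \<Omega>s]
      by eventually_elim (use K(4) in \<open>auto simp: indicator_def \<phi>_def\<close>)
  qed
  also have "\<dots> = \<phi> (LINT x|lebesgue. indicator K x *\<^sub>R \<Lambda> x)" by (rule integral_bounded_linear[OF \<phi> int])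
  finally have "0 < \<phi> (LINT x:K|lebesgue. \<Lambda> x)" by (simp add: set_lebesgue_integral_def)
  moreover have "\<phi> (cell_mean \<Lambda> K) = (1 / measure lebesgue K) * \<phi> (LINT x:K|lebesgue. \<Lambda> x)"
    unfolding cell_mean_def linear_cmul[OF bounded_linear.linear[OF \<phi>]] by simp
  ultimately show ?thesis using pos by (simp add: \<phi>_def)
qed

text \<open>The cone volume contributes one factor of the face distance. It cancels the only 1 /
  d_{K,\<sigma>} in each mixed term, leaving sums of |\<sigma>| S n that vanish, and one of the two
  in the quadratic term, which leaves the stated diagonal weight.\<close>

lemma cell_form_eq:
  fixes M :: "(real^'n) mesh" and A :: "real^'n^'n"
  assumes mesh: "polytopal_mesh \<Omega> M" and K: "K \<in> cells M"
  shows "(\<Sum>\<sigma>\<in>faces M K. measure lborel (face_cone M K \<sigma>) * ((A *v cone_grad M \<beta> K \<sigma> p) \<bullet> cone_grad M \<beta> K \<sigma> q)) =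
    measure lebesgue K * ((A *v cell_grad M K p) \<bullet> cell_grad M K q) +
    (\<Sum>\<sigma>\<in>faces M K. face_residual M K q \<sigma> *
      (face_measure \<sigma> * (\<beta> K)\<^sup>2 / (real CARD('n) * face_dist M K \<sigma>) *
        ((A *v outward_unit_normal K \<sigma>) \<bullet> outward_unit_normal K \<sigma>)) * face_residual M K p \<sigma>)"
proof -
  interpret star_polytope K "point M K" "faces M K" "outward_unit_normal K" "face_dist M K"
    by (rule mesh_cell_star_polytope[OF mesh K])
  let ?n = "outward_unit_normal K" and ?d = "face_dist M K" and ?D = "real CARD('n)"
    and ?P = "cell_grad M K p" and ?Q = "cell_grad M K q"
    and ?s = "face_residual M K p" and ?t = "face_residual M K q"
  have vol: "measure lborel (face_cone M K \<sigma>) = ?d \<sigma> / ?D * face_measure \<sigma>" if "\<sigma> \<in> faces M K" for \<sigma>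
    using measure_open_cone[OF N \<delta> hull borel_face, OF that that that that] by (simp add: face_cone_def)
  have "(\<Sum>\<sigma>\<in>faces M K. measure lborel (face_cone M K \<sigma>) * ((A *v cone_grad M \<beta> K \<sigma> p) \<bullet> cone_grad M \<beta> K \<sigma> q)) =
      (\<Sum>\<sigma>\<in>faces M K. measure lborel (face_cone M K \<sigma>) * ((A *v ?P) \<bullet> ?Q) +
        \<beta> K / ?D * (face_measure \<sigma> * ?t \<sigma> * (?n \<sigma> \<bullet> (A *v ?P))) +
        \<beta> K / ?D * (face_measure \<sigma> * ?s \<sigma> * (?n \<sigma> \<bullet> (?Q v* A))) +
        ?t \<sigma> * (face_measure \<sigma> * (\<beta> K)\<^sup>2 / (?D * ?d \<sigma>) * ((A *v ?n \<sigma>) \<bullet> ?n \<sigma>)) * ?s \<sigma>)"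
  proof (intro sum.cong refl)
    fix \<sigma> assume \<sigma>: "\<sigma> \<in> faces M K"
    define x where "x = \<beta> K / ?d \<sigma>"
    \<comment> \<open>Multiplying by the transpose of \<open>A\<close> brings this mixed term to the
      form \<open>?n \<sigma> \<bullet> v\<close> with v the same for all faces.\<close>
    have QA: "(A *v ?n \<sigma>) \<bullet> ?Q = ?n \<sigma> \<bullet> (?Q v* A)"
      using dot_lmul_matrix[of ?Q A "?n \<sigma>"] by (simp add: inner_commute)
    have "(A *v cone_grad M \<beta> K \<sigma> p) \<bullet> cone_grad M \<beta> K \<sigma> q =
        (A *v ?P) \<bullet> ?Q + x * ?t \<sigma> * (?n \<sigma> \<bullet> (A *v ?P)) + x * ?s \<sigma> * (?n \<sigma> \<bullet> (?Q v* A)) +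
        x * x * ?s \<sigma> * ?t \<sigma> * ((A *v ?n \<sigma>) \<bullet> ?n \<sigma>)"
      unfolding cone_grad_def x_def[symmetric] QA[symmetric]
      by (simp add: matrix_vector_right_distrib matrix_vector_mult_scaleR inner_add_left inner_add_right inner_commute[of "?n \<sigma>"] algebra_simps)
    then show "measure lborel (face_cone M K \<sigma>) * ((A *v cone_grad M \<beta> K \<sigma> p) \<bullet> cone_grad M \<beta> K \<sigma> q) =
        measure lborel (face_cone M K \<sigma>) * ((A *v ?P) \<bullet> ?Q) +
        \<beta> K / ?D * (face_measure \<sigma> * ?t \<sigma> * (?n \<sigma> \<bullet> (A *v ?P))) +
        \<beta> K / ?D * (face_measure \<sigma> * ?s \<sigma> * (?n \<sigma> \<bullet> (?Q v* A))) +
        ?t \<sigma> * (face_measure \<sigma> * (\<beta> K)\<^sup>2 / (?D * ?d \<sigma>) * ((A *v ?n \<sigma>) \<bullet> ?n \<sigma>)) * ?s \<sigma>"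
      using \<delta>[OF \<sigma>] by (simp add: vol[OF \<sigma>] x_def field_simps power2_eq_square)
  qed
  also have "\<dots> = (\<Sum>\<sigma>\<in>faces M K. measure lborel (face_cone M K \<sigma>)) * ((A *v ?P) \<bullet> ?Q) +
      \<beta> K / ?D * (\<Sum>\<sigma>\<in>faces M K. face_measure \<sigma> * ?t \<sigma> * (?n \<sigma> \<bullet> (A *v ?P))) +
      \<beta> K / ?D * (\<Sum>\<sigma>\<in>faces M K. face_measure \<sigma> * ?s \<sigma> * (?n \<sigma> \<bullet> (?Q v* A))) +
      (\<Sum>\<sigma>\<in>faces M K. ?t \<sigma> * (face_measure \<sigma> * (\<beta> K)\<^sup>2 / (?D * ?d \<sigma>) * ((A *v ?n \<sigma>) \<bullet> ?n \<sigma>)) * ?s \<sigma>)"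
    by (simp only: sum.distrib sum_distrib_left sum_distrib_right)
  finally show ?thesis
    unfolding sum_face_residual_normal[OF mesh K] using sum_measure_cones by (simp add: face_cone_def)
qed

theorem mainTheorem6:
  fixes \<Omega> :: "(real^'n) set"
    and M :: "(real^'n) mesh"
    and \<Lambda> :: "real^'n \<Rightarrow> real^'n^'n"
    and \<beta> :: "(real^'n) set \<Rightarrow> real"
    and B :: "(real^'n) set \<Rightarrow> (real^'n) set \<Rightarrow> (real^'n) set \<Rightarrow> real"
  assumes mesh: "polytopal_mesh \<Omega> M"
    and tensor: "diffusion_tensor \<Omega> \<Lambda>"
    and beta: "\<And>K. K \<in> cells M \<Longrightarrow> \<beta> K > 0"
    and B_diag: "\<And>K \<sigma>. K \<in> cells M \<Longrightarrow> \<sigma> \<in> faces M K \<Longrightarrow>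
      B K \<sigma> \<sigma> = face_measure \<sigma> * (\<beta> K)\<^sup>2 / (real CARD('n) * face_dist M K \<sigma>) *
        ((cell_mean \<Lambda> K *v outward_unit_normal K \<sigma>) \<bullet> outward_unit_normal K \<sigma>)"
    and B_off: "\<And>K \<sigma> \<sigma>'. K \<in> cells M \<Longrightarrow> \<sigma> \<in> faces M K \<Longrightarrow> \<sigma>' \<in> faces M K \<Longrightarrow> \<sigma> \<noteq> \<sigma>' \<Longrightarrow>
      B K \<sigma> \<sigma>' = 0"
  shows "(\<forall>p\<in>hybrid_space M. \<forall>q\<in>hybrid_space M. fe_form \<Omega> M \<Lambda> \<beta> p q = hybrid_form M \<Lambda> B p q) \<and>
    (\<forall>K\<in>cells M. sym_pos_def_on (faces M K) (B K)) \<and>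
    generalized_hybrid M \<Lambda> (fe_form \<Omega> M \<Lambda> \<beta>)"
proof -
  have diag: "(\<Sum>\<sigma>'\<in>faces M K. v \<sigma> * B K \<sigma> \<sigma>' * w \<sigma>') = v \<sigma> * B K \<sigma> \<sigma> * w \<sigma>"
    if K: "K \<in> cells M" and \<sigma>: "\<sigma> \<in> faces M K" for K \<sigma> v w
  proof -
    have "finite (faces M K)" using mesh K by (auto simp: polytopal_mesh_def)
    have "(\<Sum>\<sigma>'\<in>faces M K. v \<sigma> * B K \<sigma> \<sigma>' * w \<sigma>') = (\<Sum>\<sigma>'\<in>faces M K. if \<sigma>' = \<sigma> then v \<sigma> * B K \<sigma> \<sigma> * w \<sigma> else 0)"
      by (intro sum.cong refl) (auto simp: B_off[OF K \<sigma>])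
    then show ?thesis using \<open>finite (faces M K)\<close> \<sigma> by simp
  qed
  have form: "fe_form \<Omega> M \<Lambda> \<beta> p q = hybrid_form M \<Lambda> B p q" for p q
  proof -
    have "fe_form \<Omega> M \<Lambda> \<beta> p q = (\<Sum>K\<in>cells M.
        measure lebesgue K * ((cell_mean \<Lambda> K *v cell_grad M K p) \<bullet> cell_grad M K q) +
        (\<Sum>\<sigma>\<in>faces M K. face_residual M K q \<sigma> * B K \<sigma> \<sigma> * face_residual M K p \<sigma>))"
      unfolding fe_form_eq_sum_cones[OF mesh]
      by (intro sum.cong refl) (simp only: cell_form_eq[OF mesh] B_diag cong: sum.cong)
    also have "\<dots> = hybrid_form M \<Lambda> B p q"
      unfolding hybrid_form_def sum.distrib by (simp add: diag cong: sum.cong)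
    finally show ?thesis .
  qed
  have spd: "sym_pos_def_on (faces M K) (B K)" if K: "K \<in> cells M" for K
  proof -
    interpret star_polytope K "point M K" "faces M K" "outward_unit_normal K" "face_dist M K"
      by (rule mesh_cell_star_polytope[OF mesh K])
    have \<Omega>: "open \<Omega>" "K \<subseteq> \<Omega>"
      using mesh K by (auto simp: polytopal_mesh_def polytopal_open_def null_partition_def)
    \<comment> \<open>Every factor is positive: the face measure, the squared parameter, the
      distance, and the normal component of the mean tensor by coercivity applied to a unit
      vector.\<close>
    have B_pos: "B K \<sigma> \<sigma> > 0" if \<sigma>: "\<sigma> \<in> faces M K" for \<sigma>
    proof -
      have "(cell_mean \<Lambda> K *v outward_unit_normal K \<sigma>) \<bullet> outward_unit_normal K \<sigma> > 0"
        using a_in N[OF \<sigma>] by (intro cell_mean_coercive[OF tensor open_K bounded_K _ \<Omega>(2,1)]) auto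
      then show ?thesis
        unfolding B_diag[OF K \<sigma>] using face_measure_pos[OF \<sigma>] beta[OF K] \<delta>[OF \<sigma>] by simp
    qed
    have "(\<Sum>\<sigma>\<in>faces M K. \<Sum>\<sigma>'\<in>faces M K. v \<sigma> * B K \<sigma> \<sigma>' * v \<sigma>') > 0"
      if v: "\<exists>\<sigma>\<in>faces M K. v \<sigma> \<noteq> 0" for v
    proof -
      obtain \<tau> where \<tau>: "\<tau> \<in> faces M K" "v \<tau> \<noteq> 0" using v by blast
      have eq: "v \<sigma> * B K \<sigma> \<sigma> * v \<sigma> = B K \<sigma> \<sigma> * (v \<sigma>)\<^sup>2" for \<sigma> by (simp add: power2_eq_square)
      have "(\<Sum>\<sigma>\<in>faces M K. v \<sigma> * B K \<sigma> \<sigma> * v \<sigma>) > 0"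
        unfolding eq using B_pos \<tau> finite_F by (intro sum_pos2[of _ \<tau>]) (auto intro!: mult_nonneg_nonneg intro: less_imp_le)
      then show ?thesis by (simp add: diag[OF K] cong: sum.cong)
    qed
    moreover have "B K \<sigma> \<sigma>' = B K \<sigma>' \<sigma>" if "\<sigma> \<in> faces M K" "\<sigma>' \<in> faces M K" for \<sigma> \<sigma>'
      using B_off[OF K that] B_off[OF K that(2,1)] by (cases "\<sigma> = \<sigma>'") auto
    ultimately show ?thesis unfolding sym_pos_def_on_def by blast
  qed
  show ?thesis
    unfolding generalized_hybrid_def using form spd by blast
qed

end
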